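(* Let $n\ge 2$ and let $K,T\subseteq \mathbb{R}^n$ be compact sets with connected boundary. Then $$\mathrm{vol}\left(\frac{\partial K + \partial T }{2}\right) \ge \sqrt{\mathrm{vol}(K)\, \mathrm{vol}(T)}.$$ Moreover, when $K$ and $T$ are convex bodies, equality holds if and only if either $T$ is a translation of $K$, or $n=2$ and $K,T\subseteq\mathbb{R}^2$ are, up to translation, homothetic and centrally-symmetric.
   Context: $\mathrm{vol}$ denotes Lebesgue measure on $\mathbb{R}^n$; $\partial A$ is the topological boundary of $A$; $A+B=\{a+b: a\in A, b\in B\}$ and $\lambda A=\{\lambda a: a\in A\}$, so $\frac{\partial K+\partial T}{2}=\{\frac{x+y}{2}: x\in\partial K, y\in\partial T\}$. A convex body is a compact convex set with non-empty interior. Each of $K$ and $T$ separately is assumed to have connected boundary. "Homothetic up to translation" means $T=aK+v$ for some $a>0$ and $v\in\mathbb{R}^n$; "centrally-symmetric up to translation" means some translate $M$ of the set satisfies $M=-M$. *)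

theory Defs
  imports "HOL-Analysis.Analysis"
begin

definition convex_body :: "'a::euclidean_space set \<Rightarrow> bool" where
  "convex_body K \<longleftrightarrow> compact K \<and> convex K \<and> interior K \<noteq> {}"

definition translate_of :: "'a::real_vector set \<Rightarrow> 'a set \<Rightarrow> bool" where
  "translate_of T K \<longleftrightarrow> (\<exists>v. T = (\<lambda>x. x + v) ` K)"

definition homothetic_upto_translation :: "'a::real_vector set \<Rightarrow> 'a set \<Rightarrow> bool" where
  "homothetic_upto_translation K T \<longleftrightarrow> (\<exists>a>0. \<exists>v. T = (\<lambda>x. a *\<^sub>R x + v) ` K)"

definition centrally_symmetric_upto_translation :: "'a::real_vector set \<Rightarrow> bool" where
  "centrally_symmetric_upto_translation K \<longleftrightarrow>
     (\<exists>M. translate_of M K \<and> M = uminus ` M)"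

(* The sum of sets is the pointwise (Minkowski) sum of HOL-Library.Set_Algebras. *)
definition minkowski_average :: "'a::real_vector set \<Rightarrow> 'a set \<Rightarrow> 'a set" where
  "minkowski_average A B = (\<lambda>z. (1/2) *\<^sub>R z) ` (A + B)"

end

theory Submission
  imports Defs "HOL-Probability.Distribution_Functions"
begin

text \<open>Outside of \<open>\<partial>K + \<partial>T\<close> a point \<open>z\<close> of \<open>K + T\<close> has the property that one of the bodies \<open>K\<close>, \<open>z - T\<close> lies in
  the interior of the other; if \<open>vol T \<le> vol K\<close> it must be \<open>z - T\<close>. So the set \<open>E\<close> of these points satisfies
  \<open>E - T \<subseteq> K\<close>. With \<open>k\<close>, \<open>t\<close> the \<open>n\<close>-th roots of the volumes, Brunn-Minkowski bounds \<open>vol (K + T)\<close> below by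
  \<open>(k + t)^n\<close> and \<open>vol E\<close> above by \<open>(k - t)^n\<close>, and \<open>(k + t)^n - (k - t)^n \<ge> 2^n (k t)^(n/2)\<close> since
  \<open>(k + t)^2 = (k - t)^2 + 4 k t\<close>. Equality forces equality in Brunn-Minkowski, so \<open>K\<close> and \<open>T\<close> are homothetic;
  for \<open>n \<ge> 3\<close> also \<open>k = t\<close>, and for \<open>n = 2\<close> either \<open>k = t\<close> or the second application of Brunn-Minkowski is sharp
  as well, which makes \<open>K\<close> homothetic to \<open>- T\<close> and hence symmetric.

  Brunn-Minkowski comes from the Prekopa-Leindler inequality. For its equality case with
  \<open>vol K = vol T = 1\<close>, let \<open>F\<close> and \<open>G\<close> be the distribution functions of the volumes of \<open>K\<close> and \<open>T\<close> in a direction \<open>u\<close>.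
  If \<open>F s = G r = p\<close> then \<open>F (s + d) G (r - d) \<le> p^2\<close> for all \<open>d\<close>, which forces \<open>G\<close> to be a translate of \<open>F\<close>;
  comparing centroids, the shift is linear in \<open>u\<close>, so \<open>T\<close> is a translate of \<open>K\<close>.\<close>

section \<open>The Prekopa-Leindler inequality\<close>

text \<open>Intersecting \<open>A\<close> with a large ball loses little volume by continuity from
  below, and a closed inner approximation of this bounded piece is compact.\<close>

lemma lebesgue_inner_compact:
  fixes A :: "'a::euclidean_space set"
  assumes A: "A \<in> sets lebesgue" and c: "c < emeasure lebesgue A"
  obtains K where "compact K" "K \<subseteq> A" "c < emeasure lebesgue K"
proof -
  have [measurable]: "A \<inter> cball 0 (real n) \<in> sets lebesgue" for n
    using A by auto
  have "(SUP n. emeasure lebesgue (A \<inter> cball 0 (real n))) = emeasure lebesgue (\<Union>n. A \<inter> cball 0 (real n))"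
    by (rule SUP_emeasure_incseq) (auto simp: incseq_def intro: order_trans)
  also have "(\<Union>n. A \<inter> cball 0 (real n)) = A"
    by (auto simp: real_arch_simple)
  finally have "c < (SUP n. emeasure lebesgue (A \<inter> cball 0 (real n)))"
    using c by (simp only:)
  then obtain n where n: "c < emeasure lebesgue (A \<inter> cball 0 (real n))"
    unfolding less_SUP_iff by blast
  let ?B = "A \<inter> cball 0 (real n)"
  have "emeasure lebesgue ?B \<le> emeasure lebesgue (cball (0::'a) (real n))"
    by (rule emeasure_mono) auto
  also have "\<dots> < \<infinity>"
    using emeasure_lborel_cball_finite by auto
  finally have fin: "emeasure lebesgue ?B < \<infinity>" .
  define m where "m = measure lebesgue ?B"
  have m: "emeasure lebesgue ?B = ennreal m"
    using fin by (simp add: m_def emeasure_eq_ennreal_measure top.not_eq_extremum)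
  obtain c' where c': "c = ennreal c'" "c' \<ge> 0" using n m
    by (cases c) auto
  have cm: "c' < m" using n m c' by (simp add: ennreal_less_iff)
  obtain T where T: "closed T" "T \<subseteq> ?B" "?B - T \<in> lmeasurable" "emeasure lebesgue (?B - T) < ennreal (m - c')"
    using sets_lebesgue_inner_closed[of ?B "m - c'"] cm A by auto
  have "compact T"
    using T bounded_subset[of "cball 0 (real n)" T] by (auto simp: compact_eq_bounded_closed)
  moreover have "c < emeasure lebesgue T"
  proof -
    have Tm: "T \<in> sets lebesgue" using T by (simp add: lmeasurable_compact \<open>compact T\<close> fmeasurableD)
    have "ennreal m = emeasure lebesgue T + emeasure lebesgue (?B - T)"
      using plus_emeasure[of T lebesgue "?B - T"] T Tm m by (auto simp: fmeasurableD Un_absorb1)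
    moreover obtain t where t: "emeasure lebesgue T = ennreal t" "t \<ge> 0"
      using lmeasurable_compact[OF \<open>compact T\<close>] by (metis emeasure_eq_measure2 measure_nonneg)
    moreover obtain s where s: "emeasure lebesgue (?B - T) = ennreal s" "s \<ge> 0"
      using T by (metis emeasure_eq_measure2 measure_nonneg)
    ultimately have "ennreal m = ennreal (t + s)" by (simp only: ennreal_plus)
    hence "m = t + s" using t s m_def ennreal_inj[of m "t + s"] by (simp del: ennreal_plus)
    moreover have "s < m - c'" using T(4) s by (simp add: ennreal_less_iff)
    ultimately show ?thesis using t c' by (simp add: ennreal_less_iff)
  qed
  ultimately show ?thesis using T that by blast
qed

text \<open>The translates of \<open>A\<close> by the minimum of \<open>B\<close> and of
  \<open>B\<close> by the maximum of \<open>A\<close> both lie in \<open>C\<close>, and they share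
  only the point max A + min B.\<close>

lemma emeasure_add_le_compact_real:
  fixes A B C :: "real set"
  assumes "compact A" "compact B" "A \<noteq> {}" "B \<noteq> {}" "C \<in> sets lebesgue"
    and sum: "\<And>a b. a \<in> A \<Longrightarrow> b \<in> B \<Longrightarrow> a + b \<in> C"
  shows "emeasure lebesgue A + emeasure lebesgue B \<le> emeasure lebesgue C"
proof -
  obtain \<alpha> where \<alpha>: "\<alpha> \<in> A" "\<And>x. x \<in> A \<Longrightarrow> x \<le> \<alpha>"
    using compact_attains_sup[OF assms(1,3)] by blast
  obtain \<beta> where \<beta>: "\<beta> \<in> B" "\<And>x. x \<in> B \<Longrightarrow> \<beta> \<le> x"
    using compact_attains_inf[OF assms(2,4)] by blast
  let ?A = "(\<lambda>x. 1 *\<^sub>R x + \<beta>) ` A" and ?B = "(\<lambda>x. 1 *\<^sub>R x + \<alpha>) ` B"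
  have m: "?A \<in> sets lebesgue" "?B \<in> sets lebesgue"
    using assms by (auto intro!: fmeasurableD lmeasurable_compact compact_continuous_image continuous_intros)
  have "?A \<inter> ?B \<subseteq> {\<alpha> + \<beta>}"
    using \<alpha> \<beta> by fastforce
  hence "negligible (?A \<inter> ?B)" using negligible_sing negligible_subset by blast
  hence "?A \<inter> ?B \<in> null_sets lebesgue"
    by (simp only: negligible_iff_null_sets)
  hence "emeasure lebesgue (?A \<union> ?B) = emeasure lebesgue ?A + emeasure lebesgue ?B"
    by (rule emeasure_Un'[OF m])
  moreover have "emeasure lebesgue ?A = emeasure lebesgue A" "emeasure lebesgue ?B = emeasure lebesgue B"
    by (simp_all only: emeasure_lebesgue_affine) auto
  moreover have "emeasure lebesgue (?A \<union> ?B) \<le> emeasure lebesgue C"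
    using \<alpha>(1) \<beta>(1) sum assms(5) by (intro emeasure_mono) (auto simp: add.commute[of _ \<alpha>])
  ultimately show ?thesis by simp
qed

lemma lebesgue_eq_SUP_compact:
  fixes A :: "'a::euclidean_space set"
  assumes "A \<in> sets lebesgue" "A \<noteq> {}"
  shows "emeasure lebesgue A = (SUP K\<in>{K. compact K \<and> K \<noteq> {} \<and> K \<subseteq> A}. emeasure lebesgue K)"
proof (rule antisym)
  obtain a where "a \<in> A" using assms by blast
  show "emeasure lebesgue A \<le> (SUP K\<in>{K. compact K \<and> K \<noteq> {} \<and> K \<subseteq> A}. emeasure lebesgue K)"
  proof (rule dense_le)
    fix c assume "c < emeasure lebesgue A"
    then obtain K where K: "compact K" "K \<subseteq> A" "c < emeasure lebesgue K"
      using lebesgue_inner_compact[OF assms(1)] by blast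
    have "K \<noteq> {}" using K by auto
    then show "c \<le> (SUP K\<in>{K. compact K \<and> K \<noteq> {} \<and> K \<subseteq> A}. emeasure lebesgue K)"
      using K by (intro SUP_upper2[of K]) auto
  qed
  show "(SUP K\<in>{K. compact K \<and> K \<noteq> {} \<and> K \<subseteq> A}. emeasure lebesgue K) \<le> emeasure lebesgue A"
    using assms by (intro SUP_least emeasure_mono) auto
qed

text \<open>Both volumes are suprema over compact subsets, for which the bound is known. A
  measurable \<open>C\<close> containing all sums replaces the sum set, which need not be
  measurable.\<close>

lemma emeasure_add_le_real:
  fixes A B C :: "real set"
  assumes A: "A \<in> sets lebesgue" "A \<noteq> {}" and B: "B \<in> sets lebesgue" "B \<noteq> {}" and C: "C \<in> sets lebesgue"
    and sum: "\<And>a b. a \<in> A \<Longrightarrow> b \<in> B \<Longrightarrow> a + b \<in> C"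
  shows "emeasure lebesgue A + emeasure lebesgue B \<le> emeasure lebesgue C"
proof -
  have ne: "{K. compact K \<and> K \<noteq> {} \<and> K \<subseteq> X} \<noteq> {}" if "X \<noteq> {}" for X :: "real set"
    using that by (auto intro!: exI[of _ "{SOME x. x \<in> X}"] some_in_eq[THEN iffD2])
  show ?thesis
    unfolding lebesgue_eq_SUP_compact[OF A] lebesgue_eq_SUP_compact[OF B]
    apply (subst ennreal_SUP_add_left[symmetric], use ne[OF A(2)] in simp)
    apply (subst ennreal_SUP_add_right, use ne[OF B(2)] in simp)
    apply (intro SUP_least)
    apply (rule emeasure_add_le_compact_real)
    using sum C by auto
qed

lemma emeasure_convex_comb_le_real:
  fixes A B C :: "real set"
  assumes A: "A \<in> sets lebesgue" "A \<noteq> {}" and B: "B \<in> sets lebesgue" "B \<noteq> {}" and C: "C \<in> sets lebesgue"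
    and u: "0 < u" "0 < v"
    and sum: "\<And>a b. a \<in> A \<Longrightarrow> b \<in> B \<Longrightarrow> u * a + v * b \<in> C"
  shows "ennreal u * emeasure lebesgue A + ennreal v * emeasure lebesgue B \<le> emeasure lebesgue C"
proof -
  have *: "ennreal w * emeasure lebesgue X = emeasure lebesgue ((\<lambda>x. w *\<^sub>R x + 0) ` X)" if "w > 0" for w and X :: "real set"
    using that by (simp only: emeasure_lebesgue_affine) auto
  have meas: "(\<lambda>x. w *\<^sub>R x + 0) ` X \<in> sets lebesgue" if "w > 0" "X \<in> sets lebesgue" for w and X :: "real set"
  proof -
    have "(\<lambda>x. w *\<^sub>R x + 0) ` X = (*\<^sub>R) (1/w) -` X \<inter> space lebesgue"
      using that by (force simp: image_iff)
    thus ?thesis using measurable_sets[OF lebesgue_measurable_scaling that(2)] by simp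
  qed
  show ?thesis
    unfolding *[OF u(1)] *[OF u(2)]
    using sum by (intro emeasure_add_le_real meas A B C u) (use A B in auto)
qed

section \<open>Weighted geometric means\<close>

text \<open>Since \<open>0 powr u = 0\<close> for every \<open>u\<close>, the mean vanishes as soon
  as one argument does, even for a weight of 0 or 1.\<close>

definition geom_mean :: "real \<Rightarrow> real \<Rightarrow> real \<Rightarrow> real" where
  "geom_mean u a b = a powr u * b powr (1 - u)"

lemma geom_mean_nonneg [simp]: "0 \<le> geom_mean u a b"
  by (simp add: geom_mean_def)

lemma geom_mean_zero [simp]: "geom_mean u 0 b = 0" "geom_mean u a 0 = 0"
  by (simp_all add: geom_mean_def)

lemma geom_mean_pos: "0 < a \<Longrightarrow> 0 < b \<Longrightarrow> 0 < geom_mean u a b"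
  by (simp add: geom_mean_def)

lemma geom_mean_same: "0 \<le> a \<Longrightarrow> geom_mean u a a = a"
  by (cases "a = 0") (simp_all add: geom_mean_def flip: powr_add)

lemma geom_mean_mono:
  assumes "0 \<le> a" "a \<le> a'" "0 \<le> b" "b \<le> b'" "0 \<le> u" "u \<le> 1"
  shows "geom_mean u a b \<le> geom_mean u a' b'"
  unfolding geom_mean_def using assms by (intro mult_mono powr_mono2) auto

lemma min_le_geom_mean:
  assumes "0 \<le> a" "0 \<le> b" "0 \<le> u" "u \<le> 1"
  shows "min a b \<le> geom_mean u a b"
  using geom_mean_mono[of "min a b" a "min a b" b u] geom_mean_same[of "min a b" u] assms by auto

lemma geom_mean_divide:
  assumes "0 \<le> a" "0 \<le> b" "0 < c" "0 < d"
  shows "geom_mean u (a / c) (b / d) = geom_mean u a b / geom_mean u c d"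
  unfolding geom_mean_def using assms by (simp add: powr_divide)

lemma geom_mean_le_arith:
  assumes "0 \<le> a" "0 \<le> b" "0 \<le> u" "u \<le> 1"
  shows "geom_mean u a b \<le> u * a + (1 - u) * b"
proof (cases "a = 0 \<or> b = 0")
  case True
  then show ?thesis using assms by auto
next
  case False
  then show ?thesis unfolding geom_mean_def using assms by (intro Youngs_inequality_0) auto
qed

section \<open>The functional inequality on the line via superlevel sets\<close>

text \<open>The value \<open>f x\<close> is the length of the set of t with 0 < t <
  \<open>f x\<close>; Fubini exchanges the two integrations.\<close>

lemma nn_integral_layer_cake:
  fixes f :: "'a \<Rightarrow> ennreal"
  assumes "sigma_finite_measure M" and f[measurable]: "f \<in> borel_measurable M"
  shows "(\<integral>\<^sup>+x. f x \<partial>M) = (\<integral>\<^sup>+t. indicator {0<..} t * emeasure M {x\<in>space M. ennreal t < f x} \<partial>lborel)"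
proof -
  interpret M: sigma_finite_measure M by fact
  interpret P: pair_sigma_finite M "lborel :: real measure" by standard
  have *: "(\<integral>\<^sup>+t. indicator {0<..} t * indicator {t. ennreal t < v} t \<partial>lborel) = v" for v
  proof (cases v)
    case (real r)
    have "(\<integral>\<^sup>+t. indicator {0<..} t * indicator {t. ennreal t < v} t \<partial>lborel) = (\<integral>\<^sup>+t. indicator {0<..<r} t \<partial>lborel)"
      using real by (intro nn_integral_cong) (auto simp: indicator_def ennreal_less_iff)
    then show ?thesis using real by simp
  next
    case top
    have "(\<integral>\<^sup>+t. indicator {0<..} t * indicator {t. ennreal t < v} t \<partial>lborel) = (\<integral>\<^sup>+t. indicator {0::real<..} t \<partial>lborel)"
      using top by (intro nn_integral_cong) (auto simp: indicator_def)
    also have "\<dots> = emeasure lborel {0::real<..}" by simp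
    \<comment> \<open>A finite length \<open>r\<close> of the half-line is contradicted by the
      interval from 0 to \<open>r + 1\<close> inside it.\<close>
    also have "\<dots> = \<infinity>"
    proof (rule ccontr)
      assume "emeasure lborel {0::real<..} \<noteq> \<infinity>"
      then obtain r where r: "emeasure lborel {0::real<..} = ennreal r" "0 \<le> r"
        by (cases "emeasure lborel {0::real<..}") auto
      have "emeasure lborel {0<..<r+1} \<le> emeasure lborel {0::real<..}"
        by (intro emeasure_mono) auto
      then show False using r by simp
    qed
    finally show ?thesis using top by simp
  qed
  have "(\<integral>\<^sup>+x. f x \<partial>M) = (\<integral>\<^sup>+x. (\<integral>\<^sup>+t. indicator {0<..} t * indicator {t. ennreal t < f x} t \<partial>lborel) \<partial>M)"
    by (simp only: *)
  also have "\<dots> = (\<integral>\<^sup>+t. (\<integral>\<^sup>+x. indicator {0<..} t * indicator {t. ennreal t < f x} t \<partial>M) \<partial>lborel)"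
    by (rule P.Fubini'[symmetric]) measurable
  also have "\<dots> = (\<integral>\<^sup>+t. indicator {0<..} t * emeasure M {x\<in>space M. ennreal t < f x} \<partial>lborel)"
  proof (intro nn_integral_cong)
    fix t :: real
    have "(\<integral>\<^sup>+x. indicator {0<..} t * indicator {t. ennreal t < f x} t \<partial>M)
       = (\<integral>\<^sup>+x. indicator {0<..} t * indicator {x\<in>space M. ennreal t < f x} x \<partial>M)"
      by (intro nn_integral_cong) (auto simp: indicator_def)
    also have "\<dots> = indicator {0<..} t * emeasure M {x\<in>space M. ennreal t < f x}"
      by (subst nn_integral_cmult) auto
    finally show "(\<integral>\<^sup>+x. indicator {0<..} t * indicator {t. ennreal t < f x} t \<partial>M) = \<dots>" .
  qed
  finally show ?thesis .
qed

text \<open>With both suprema equal to 1, the superlevel sets of \<open>f\<close> and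
  \<open>g\<close> are nonempty at exactly the same heights 0 < t < 1. There the additive inequality
  for sets applies, because the sum of these two sets falls into the superlevel set of
  \<open>h\<close>; integrating over t gives the claim.\<close>

lemma prekopa_leindler_real_normalized:
  fixes f g :: "real \<Rightarrow> real" and h :: "real \<Rightarrow> ennreal"
  assumes [measurable]: "f \<in> borel_measurable borel" "g \<in> borel_measurable borel" "h \<in> borel_measurable borel"
    and u: "0 < u" "u < 1"
    and f: "\<And>x. 0 \<le> f x" "\<And>x. f x \<le> 1" "\<And>t. t < 1 \<Longrightarrow> \<exists>x. t < f x"
    and g: "\<And>x. 0 \<le> g x" "\<And>x. g x \<le> 1" "\<And>t. t < 1 \<Longrightarrow> \<exists>x. t < g x"
    and h: "\<And>x y. ennreal (min (f x) (g y)) \<le> h (u * x + (1 - u) * y)"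
  shows "ennreal u * (\<integral>\<^sup>+x. f x \<partial>lborel) + ennreal (1 - u) * (\<integral>\<^sup>+x. g x \<partial>lborel) \<le> (\<integral>\<^sup>+x. h x \<partial>lborel)"
proof -
  let ?S = "\<lambda>f t. {x::real. ennreal t < f x}"
  have lc: "(\<integral>\<^sup>+x. f x \<partial>lborel) = (\<integral>\<^sup>+t. indicator {0<..} t * emeasure lborel (?S f t) \<partial>lborel)"
    if "f \<in> borel_measurable borel" for f :: "real \<Rightarrow> ennreal"
    using nn_integral_layer_cake[OF sigma_finite_lborel, of f] that by simp
  have "ennreal u * (\<integral>\<^sup>+x. f x \<partial>lborel) + ennreal (1 - u) * (\<integral>\<^sup>+x. g x \<partial>lborel)
     = (\<integral>\<^sup>+t. ennreal u * (indicator {0<..} t * emeasure lborel (?S (\<lambda>x. f x) t)) +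
        ennreal (1 - u) * (indicator {0<..} t * emeasure lborel (?S (\<lambda>x. g x) t)) \<partial>lborel)"
    unfolding lc[OF measurable_compose[OF assms(1) measurable_ennreal]] lc[OF measurable_compose[OF assms(2) measurable_ennreal]]
    by (simp add: nn_integral_cmult nn_integral_add)
  also have "\<dots> \<le> (\<integral>\<^sup>+t. indicator {0<..} t * emeasure lborel (?S h t) \<partial>lborel)"
  proof (intro nn_integral_mono)
    fix t :: real
    consider "t \<le> 0" | "t \<ge> 1" | "0 < t" "t < 1" by linarith
    then show "ennreal u * (indicator {0<..} t * emeasure lborel (?S (\<lambda>x. f x) t)) +
        ennreal (1 - u) * (indicator {0<..} t * emeasure lborel (?S (\<lambda>x. g x) t))
        \<le> indicator {0<..} t * emeasure lborel (?S h t)"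
    proof cases
      case 1
      then show ?thesis by simp
    next
      case 2
      then have "?S (\<lambda>x. f x) t = {}" "?S (\<lambda>x. g x) t = {}"
        using order_trans[OF f(2), of t] order_trans[OF g(2), of t] f(1) g(1) by (auto simp: ennreal_less_iff not_less)
      then show ?thesis by simp
    next
      case 3
      have [simp]: "emeasure lebesgue (?S F t) = emeasure lborel (?S F t)" if [measurable]: "F \<in> borel_measurable borel" for F
        by (simp add: main_part_sets)
      have "ennreal u * emeasure lebesgue (?S (\<lambda>x. f x) t) + ennreal (1 - u) * emeasure lebesgue (?S (\<lambda>x. g x) t) \<le> emeasure lebesgue (?S h t)"
      proof (rule emeasure_convex_comb_le_real)
        show "?S (\<lambda>x. f x) t \<noteq> {}" "?S (\<lambda>x. g x) t \<noteq> {}"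
          using f(3) g(3) 3 by (auto simp: ennreal_less_iff)
        fix a b assume "a \<in> ?S (\<lambda>x. f x) t" "b \<in> ?S (\<lambda>x. g x) t"
        then have "ennreal t < ennreal (min (f a) (g b))"
          using 3 by (auto simp: ennreal_less_iff)
        also note h
        finally show "u * a + (1 - u) * b \<in> ?S h t" by simp
      qed (use u in auto)
      then show ?thesis using 3 by simp
    qed
  qed
  also have "\<dots> = (\<integral>\<^sup>+x. h x \<partial>lborel)" by (rule lc[symmetric]) simp
  finally show ?thesis .
qed

text \<open>Dividing by the suprema \<open>a\<close> and \<open>b\<close> reduces to the normalized
  case, which bounds an arithmetic mean of the two integrals. The arithmetic-geometric mean
  inequality then weakens this to a geometric mean, from which the normalizing factors
  cancel.\<close>

lemma prekopa_leindler_real_bounded: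
  fixes f g :: "real \<Rightarrow> real" and h :: "real \<Rightarrow> ennreal"
  assumes [measurable]: "f \<in> borel_measurable borel" "g \<in> borel_measurable borel" "h \<in> borel_measurable borel"
    and u: "0 < u" "u < 1"
    and f: "\<And>x. 0 \<le> f x" "\<And>x. f x \<le> B" "(\<integral>\<^sup>+x. f x \<partial>lborel) = ennreal F" "0 \<le> F"
    and g: "\<And>x. 0 \<le> g x" "\<And>x. g x \<le> B" "(\<integral>\<^sup>+x. g x \<partial>lborel) = ennreal G" "0 \<le> G"
    and h: "\<And>x y. ennreal (geom_mean u (f x) (g y)) \<le> h (u * x + (1 - u) * y)"
  shows "ennreal (geom_mean u F G) \<le> (\<integral>\<^sup>+x. h x \<partial>lborel)"
proof (cases "(\<exists>x. f x > 0) \<and> (\<exists>x. g x > 0)")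
  case False
  then have "(\<forall>x. f x = 0) \<or> (\<forall>x. g x = 0)" using f(1) g(1) by (metis less_eq_real_def)
  then have "F = 0 \<or> G = 0" using f(3,4) g(3,4) by auto
  then show ?thesis by auto
next
  case True
  define a where "a = Sup (range f)"
  define b where "b = Sup (range g)"
  have bdd: "bdd_above (range f)" "bdd_above (range g)" using f(2) g(2) by (auto simp: bdd_above_def)
  have fa: "f x \<le> a" and gb: "g x \<le> b" for x
    unfolding a_def b_def by (auto intro: cSup_upper bdd)
  have ab: "0 < a" "0 < b" using True fa gb by (meson less_le_trans)+
  have c: "0 < geom_mean u a b" by (rule geom_mean_pos[OF ab])
  \<comment> \<open>The third function is \<open>h\<close> divided by
    \<open>geom_mean u a b\<close>; its hypothesis holds because a minimum is at most the weighted
    geometric mean.\<close>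
  have "ennreal u * (\<integral>\<^sup>+x. ennreal (f x / a) \<partial>lborel) + ennreal (1 - u) * (\<integral>\<^sup>+x. ennreal (g x / b) \<partial>lborel)
     \<le> (\<integral>\<^sup>+x. ennreal (1 / geom_mean u a b) * h x \<partial>lborel)"
  proof (rule prekopa_leindler_real_normalized)
    fix t :: real assume t: "t < 1"
    have "t * a < a" "t * b < b" using t ab by auto
    then show "\<exists>x. t < f x / a" "\<exists>x. t < g x / b"
      using less_cSup_iff[OF _ bdd(1), of "t * a"] less_cSup_iff[OF _ bdd(2), of "t * b"] ab
      by (auto simp: a_def[symmetric] b_def[symmetric] pos_less_divide_eq)
  next
    fix x y
    have "min (f x / a) (g y / b) \<le> geom_mean u (f x / a) (g y / b)"
      using f(1) g(1) ab u by (intro min_le_geom_mean) auto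
    also have "\<dots> = 1 / geom_mean u a b * geom_mean u (f x) (g y)"
      using ab f(1) g(1) by (simp add: geom_mean_divide)
    finally have "ennreal (min (f x / a) (g y / b)) \<le> ennreal (1 / geom_mean u a b) * ennreal (geom_mean u (f x) (g y))"
      by (subst ennreal_mult[symmetric]) auto
    also have "\<dots> \<le> ennreal (1 / geom_mean u a b) * h (u * x + (1 - u) * y)"
      by (intro mult_left_mono h) auto
    finally show "ennreal (min (f x / a) (g y / b)) \<le> \<dots>" .
  qed (use fa gb ab f(1) g(1) u in auto)
  also have "(\<integral>\<^sup>+x. ennreal (1 / geom_mean u a b) * h x \<partial>lborel) = ennreal (1 / geom_mean u a b) * (\<integral>\<^sup>+x. h x \<partial>lborel)"
    by (rule nn_integral_cmult) simp
  also have "(\<integral>\<^sup>+x. ennreal (f x / a) \<partial>lborel) = ennreal (F / a)"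
  proof -
    have "(\<integral>\<^sup>+x. ennreal (f x / a) \<partial>lborel) = (\<integral>\<^sup>+x. ennreal (1 / a) * ennreal (f x) \<partial>lborel)"
      using ab f(1) by (intro nn_integral_cong) (simp flip: ennreal_mult)
    also have "\<dots> = ennreal (F / a)"
      using ab f(3,4) by (simp add: nn_integral_cmult flip: ennreal_mult)
    finally show ?thesis .
  qed
  also have "(\<integral>\<^sup>+x. ennreal (g x / b) \<partial>lborel) = ennreal (G / b)"
  proof -
    have "(\<integral>\<^sup>+x. ennreal (g x / b) \<partial>lborel) = (\<integral>\<^sup>+x. ennreal (1 / b) * ennreal (g x) \<partial>lborel)"
      using ab g(1) by (intro nn_integral_cong) (simp flip: ennreal_mult)
    also have "\<dots> = ennreal (G / b)"
      using ab g(3,4) by (simp add: nn_integral_cmult flip: ennreal_mult)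
    finally show ?thesis .
  qed
  finally have *: "ennreal (u * (F / a) + (1 - u) * (G / b)) \<le> ennreal (1 / geom_mean u a b) * (\<integral>\<^sup>+x. h x \<partial>lborel)"
    using u ab f(4) g(4) by (simp flip: ennreal_mult ennreal_plus)
  have "geom_mean u F G = geom_mean u a b * geom_mean u (F / a) (G / b)"
    using ab f(4) g(4) c by (simp add: geom_mean_divide)
  also have "\<dots> \<le> geom_mean u a b * (u * (F / a) + (1 - u) * (G / b))"
    using c ab f(4) g(4) u by (intro mult_left_mono geom_mean_le_arith) auto
  finally have "ennreal (geom_mean u F G) \<le> ennreal (geom_mean u a b) * ennreal (u * (F / a) + (1 - u) * (G / b))"
    using u ab f(4) g(4) by (subst ennreal_mult[symmetric]) (auto intro: ennreal_leI)
  also have "\<dots> \<le> ennreal (geom_mean u a b) * (ennreal (1 / geom_mean u a b) * (\<integral>\<^sup>+x. h x \<partial>lborel))"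
    by (intro mult_left_mono *) auto
  also have "\<dots> = (\<integral>\<^sup>+x. h x \<partial>lborel)"
    using c by (simp add: mult.assoc[symmetric] ennreal_mult[symmetric] del: ennreal_1) simp
  finally show ?thesis .
qed

text \<open>The functions are truncated at height n, where the bounded case applies, and monotone
  convergence recovers their integrals.\<close>

lemma prekopa_leindler_real:
  fixes f g :: "real \<Rightarrow> real" and h :: "real \<Rightarrow> ennreal"
  assumes [measurable]: "f \<in> borel_measurable borel" "g \<in> borel_measurable borel" "h \<in> borel_measurable borel"
    and u: "0 < u" "u < 1"
    and f: "\<And>x. 0 \<le> f x" "(\<integral>\<^sup>+x. f x \<partial>lborel) = ennreal F" "0 \<le> F"
    and g: "\<And>x. 0 \<le> g x" "(\<integral>\<^sup>+x. g x \<partial>lborel) = ennreal G" "0 \<le> G"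
    and h: "\<And>x y. ennreal (geom_mean u (f x) (g y)) \<le> h (u * x + (1 - u) * y)"
  shows "ennreal (geom_mean u F G) \<le> (\<integral>\<^sup>+x. h x \<partial>lborel)"
proof -
  have trunc: "\<exists>F'. (\<forall>n. (\<integral>\<^sup>+x. min (f x) (real n) \<partial>lborel) = ennreal (F' n) \<and> 0 \<le> F' n) \<and> F' \<longlonglongrightarrow> F"
    if [measurable]: "f \<in> borel_measurable borel" and f: "\<And>x. 0 \<le> f x" "(\<integral>\<^sup>+x. f x \<partial>lborel) = ennreal F" "0 \<le> F"
    for f :: "real \<Rightarrow> real" and F
  proof -
    let ?I = "\<lambda>n. (\<integral>\<^sup>+x. min (f x) (real n) \<partial>lborel)"
    have le: "?I n \<le> ennreal F" for n
      unfolding f(2)[symmetric] by (intro nn_integral_mono) (simp add: ennreal_leI)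
    hence fin: "?I n < \<infinity>" for n
      by (metis ennreal_less_top infinity_ennreal_def le_less_trans)
    have lim: "?I \<longlonglongrightarrow> (\<integral>\<^sup>+x. f x \<partial>lborel)"
    proof (rule nn_integral_LIMSEQ)
      show "incseq (\<lambda>n x. ennreal (min (f x) (real n)))"
        by (auto simp: incseq_def le_fun_def intro!: ennreal_leI)
      fix x
      obtain N where N: "f x \<le> real N" using real_arch_simple by blast
      have "eventually (\<lambda>n. ennreal (min (f x) (real n)) = ennreal (f x)) sequentially"
        using eventually_ge_at_top[of N] by eventually_elim (use N in \<open>auto simp: min_def\<close>)
      thus "(\<lambda>n. ennreal (min (f x) (real n))) \<longlonglongrightarrow> ennreal (f x)"
        by (rule tendsto_eventually)
    qed simp_all
    have "(\<lambda>n. enn2real (?I n)) \<longlonglongrightarrow> enn2real (ennreal F)"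
      using lim f by (intro tendsto_enn2real) auto
    moreover have "?I n = ennreal (enn2real (?I n))" for n
      using fin[of n] by (simp add: ennreal_enn2real_if)
    ultimately show ?thesis using f by (intro exI[of _ "\<lambda>n. enn2real (?I n)"]) auto
  qed
  obtain F' where F': "\<And>n. (\<integral>\<^sup>+x. min (f x) (real n) \<partial>lborel) = ennreal (F' n)" "\<And>n. 0 \<le> F' n" "F' \<longlonglongrightarrow> F"
    using trunc[OF assms(1) f] by metis
  obtain G' where G': "\<And>n. (\<integral>\<^sup>+x. min (g x) (real n) \<partial>lborel) = ennreal (G' n)" "\<And>n. 0 \<le> G' n" "G' \<longlonglongrightarrow> G"
    using trunc[OF assms(2) g] by metis
  have le: "ennreal (geom_mean u (F' n) (G' n)) \<le> (\<integral>\<^sup>+x. h x \<partial>lborel)" for n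
  proof (rule prekopa_leindler_real_bounded[OF _ _ _ u _ _ F'(1,2) _ _ G'(1,2), where B = "real n"])
    fix x y
    have "ennreal (geom_mean u (min (f x) (real n)) (min (g y) (real n))) \<le> ennreal (geom_mean u (f x) (g y))"
      using f(1) g(1) u by (intro ennreal_leI geom_mean_mono) auto
    also note h
    finally show "ennreal (geom_mean u (min (f x) (real n)) (min (g y) (real n))) \<le> h (u * x + (1 - u) * y)" .
  qed (use f(1) g(1) in auto)
  \<comment> \<open>The limits \<open>F\<close> and \<open>G\<close> may be 0; the powers are still
    continuous there because both exponents are positive.\<close>
  have "(\<lambda>n. geom_mean u (F' n) (G' n)) \<longlonglongrightarrow> geom_mean u F G"
    unfolding geom_mean_def using u F' G'
    by (intro tendsto_mult tendsto_powr' tendsto_const) (auto simp: always_eventually)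
  hence lim: "(\<lambda>n. ennreal (geom_mean u (F' n) (G' n))) \<longlonglongrightarrow> ennreal (geom_mean u F G)"
    by (intro tendsto_ennrealI)
  show ?thesis by (rule LIMSEQ_le_const2[OF lim]) (use le in auto)
qed

text \<open>An infinite argument counts as \<open>0\<close> here, which weakens both the hypothesis and the conclusion of the
  inequality; this is harmless because the sets of interest have finite volume.\<close>

definition ennreal_geom_mean :: "real \<Rightarrow> ennreal \<Rightarrow> ennreal \<Rightarrow> ennreal" where
  "ennreal_geom_mean u a b = ennreal (geom_mean u (enn2real a) (enn2real b))"

text \<open>A function with finite integral is finite almost everywhere, so passing to real values
  keeps the integrals; if an integral is infinite, the left-hand side is 0 by convention.\<close>

lemma prekopa_leindler_ennreal:
  fixes f g h :: "real \<Rightarrow> ennreal"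
  assumes [measurable]: "f \<in> borel_measurable borel" "g \<in> borel_measurable borel" "h \<in> borel_measurable borel"
    and u: "0 < u" "u < 1"
    and h: "\<And>x y. ennreal_geom_mean u (f x) (g y) \<le> h (u * x + (1 - u) * y)"
  shows "ennreal_geom_mean u (\<integral>\<^sup>+x. f x \<partial>lborel) (\<integral>\<^sup>+x. g x \<partial>lborel) \<le> (\<integral>\<^sup>+x. h x \<partial>lborel)"
proof (cases "(\<integral>\<^sup>+x. f x \<partial>lborel) = \<infinity> \<or> (\<integral>\<^sup>+x. g x \<partial>lborel) = \<infinity>")
  case True
  then show ?thesis by (auto simp: ennreal_geom_mean_def)
next
  case False
  have *: "(\<integral>\<^sup>+x. ennreal (enn2real (f x)) \<partial>lborel) = ennreal (enn2real (\<integral>\<^sup>+x. f x \<partial>lborel))"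
    if [measurable]: "f \<in> borel_measurable borel" and fin: "(\<integral>\<^sup>+x. f x \<partial>lborel) \<noteq> \<infinity>" for f :: "real \<Rightarrow> ennreal"
  proof -
    have "AE x in lborel. f x \<noteq> \<infinity>"
      using fin by (intro nn_integral_noteq_infinite) auto
    hence "(\<integral>\<^sup>+x. ennreal (enn2real (f x)) \<partial>lborel) = (\<integral>\<^sup>+x. f x \<partial>lborel)"
      by (intro nn_integral_cong_AE) (auto simp: ennreal_enn2real_if)
    thus ?thesis using fin by (simp add: ennreal_enn2real_if)
  qed
  show ?thesis unfolding ennreal_geom_mean_def
    by (rule prekopa_leindler_real[OF _ _ _ u, where f = "\<lambda>x. enn2real (f x)" and g = "\<lambda>x. enn2real (g x)"])
       (use False h in \<open>auto simp: * ennreal_geom_mean_def\<close>)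
qed

section \<open>Higher dimensions by induction on the coordinates\<close>

text \<open>Integrating out all coordinates but \<open>i\<close> leaves three functions of one
  variable. The induction hypothesis on the slices at \<open>a\<close> and \<open>b\<close> is
  exactly the hypothesis of the one-dimensional inequality for them.\<close>

lemma prekopa_leindler_PiM:
  fixes f g h :: "('i \<Rightarrow> real) \<Rightarrow> ennreal"
  assumes "finite I" and u: "0 < u" "u < 1"
    and "f \<in> borel_measurable (PiM I (\<lambda>_. lborel))" "g \<in> borel_measurable (PiM I (\<lambda>_. lborel))"
      "h \<in> borel_measurable (PiM I (\<lambda>_. lborel))"
    and "\<And>x y z. x \<in> extensional I \<Longrightarrow> y \<in> extensional I \<Longrightarrow> z \<in> extensional I \<Longrightarrow>
       (\<And>i. i \<in> I \<Longrightarrow> z i = u * x i + (1 - u) * y i) \<Longrightarrow> ennreal_geom_mean u (f x) (g y) \<le> h z"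
  shows "ennreal_geom_mean u (integral\<^sup>N (PiM I (\<lambda>_. lborel)) f) (integral\<^sup>N (PiM I (\<lambda>_. lborel)) g)
     \<le> integral\<^sup>N (PiM I (\<lambda>_. lborel)) h"
  using assms(1,4-)
proof (induction I arbitrary: f g h rule: finite_induct)
  case empty
  then show ?case
    by (simp add: nn_integral_count_space_finite PiM_empty)
next
  case (insert i I)
  interpret product_sigma_finite "\<lambda>_::'i. lborel :: real measure" ..
  interpret I: finite_product_sigma_finite "\<lambda>_::'i. lborel :: real measure" I
    by standard (rule insert.hyps)
  note [measurable] = insert.prems(1-3)
  have meas: "(\<lambda>a. \<integral>\<^sup>+x. F (x(i := a)) \<partial>PiM I (\<lambda>_. lborel)) \<in> borel_measurable borel"
    if [measurable]: "F \<in> borel_measurable (PiM (insert i I) (\<lambda>_. lborel))" for F :: "('i \<Rightarrow> real) \<Rightarrow> ennreal"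
    by (rule I.borel_measurable_nn_integral) measurable
  have ext: "x(i := a) \<in> extensional (insert i I)" if "x \<in> extensional I" for x :: "'i \<Rightarrow> real" and a
    using that by (auto simp: extensional_def)
  show ?case
    unfolding product_nn_integral_insert_rev[OF insert.hyps insert.prems(1)]
      product_nn_integral_insert_rev[OF insert.hyps insert.prems(2)]
      product_nn_integral_insert_rev[OF insert.hyps insert.prems(3)]
  proof (rule prekopa_leindler_ennreal[OF _ _ _ u])
    fix a b :: real
    show "ennreal_geom_mean u (\<integral>\<^sup>+x. f (x(i := a)) \<partial>PiM I (\<lambda>_. lborel)) (\<integral>\<^sup>+x. g (x(i := b)) \<partial>PiM I (\<lambda>_. lborel))
      \<le> (\<integral>\<^sup>+x. h (x(i := u * a + (1 - u) * b)) \<partial>PiM I (\<lambda>_. lborel))"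
    proof (rule insert.IH)
      fix x y z :: "'i \<Rightarrow> real"
      assume "x \<in> extensional I" "y \<in> extensional I" "z \<in> extensional I"
        "\<And>j. j \<in> I \<Longrightarrow> z j = u * x j + (1 - u) * y j"
      then show "ennreal_geom_mean u (f (x(i := a))) (g (y(i := b))) \<le> h (z(i := u * a + (1 - u) * b))"
        using insert.hyps by (intro insert.prems(4) ext) auto
    qed measurable
  qed (use insert.prems(1-3) in \<open>auto intro: meas\<close>)
qed

text \<open>Lebesgue measure is the image of the product measure under the linear map from
  coordinates to vectors, which respects convex combinations.\<close>

theorem prekopa_leindler:
  fixes f g h :: "'a::euclidean_space \<Rightarrow> ennreal"
  assumes u: "0 < u" "u < 1"
    and [measurable]: "f \<in> borel_measurable borel" "g \<in> borel_measurable borel" "h \<in> borel_measurable borel"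
    and h: "\<And>x y. ennreal_geom_mean u (f x) (g y) \<le> h (u *\<^sub>R x + (1 - u) *\<^sub>R y)"
  shows "ennreal_geom_mean u (integral\<^sup>N lborel f) (integral\<^sup>N lborel g) \<le> integral\<^sup>N lborel h"
proof -
  let ?P = "PiM Basis (\<lambda>_. lborel) :: ('a \<Rightarrow> real) measure"
  let ?v = "\<lambda>x. \<Sum>b\<in>Basis. x b *\<^sub>R b :: 'a"
  have eq: "integral\<^sup>N lborel F = (\<integral>\<^sup>+x. F (?v x) \<partial>?P)" if [measurable]: "F \<in> borel_measurable borel" for F :: "'a \<Rightarrow> ennreal"
    unfolding lborel_def[where 'a='a] lborel_eq_real[symmetric]
    by (subst nn_integral_distr) auto
  show ?thesis unfolding eq[OF assms(3)] eq[OF assms(4)] eq[OF assms(5)]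
  proof (rule prekopa_leindler_PiM[OF finite_Basis u])
    fix x y z :: "'a \<Rightarrow> real"
    assume "\<And>i. i \<in> Basis \<Longrightarrow> z i = u * x i + (1 - u) * y i"
    then have "?v z = u *\<^sub>R ?v x + (1 - u) *\<^sub>R ?v y"
      by (simp add: scaleR_sum_right sum.distrib[symmetric] scaleR_add_left)
    then show "ennreal_geom_mean u (f (?v x)) (g (?v y)) \<le> h (?v z)" using h by simp
  qed measurable
qed

section \<open>The Brunn-Minkowski inequality\<close>

lemma measure_lebesgue_eq_lborel: "A \<in> sets borel \<Longrightarrow> measure lebesgue A = measure lborel A"
  by (simp add: measure_def main_part_sets)

lemma fmeasurable_lborel_affine:
  fixes A :: "'a::euclidean_space set"
  assumes A: "A \<in> fmeasurable lborel" and m: "m \<noteq> 0"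
  shows "(\<lambda>x. m *\<^sub>R x + c) ` A \<in> fmeasurable lborel"
proof -
  have "(\<lambda>x. m *\<^sub>R x + c) ` A = (\<lambda>y. (1/m) *\<^sub>R (y - c)) -` A \<inter> space borel"
    using m by (force simp: image_iff)
  moreover have "(\<lambda>y. (1/m) *\<^sub>R (y - c)) -` A \<inter> space borel \<in> sets borel"
    using A by (intro measurable_sets[of _ _ borel]) auto
  ultimately have 1: "(\<lambda>x. m *\<^sub>R x + c) ` A \<in> sets borel" by simp
  have "emeasure lborel A < \<infinity>" "A \<in> sets borel" using A by (auto simp: fmeasurable_def)
  hence "emeasure lebesgue A < \<infinity>" by (simp add: main_part_sets)
  hence "emeasure lebesgue ((\<lambda>x. m *\<^sub>R x + c) ` A) < \<infinity>"
    by (simp only: emeasure_lebesgue_affine) (simp add: ennreal_mult_less_top)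
  thus ?thesis using 1 by (auto simp: fmeasurable_def main_part_sets)
qed

text \<open>This is the Prekopa-Leindler inequality for indicator functions. The sets are taken
  Borel because that inequality is about Borel functions.\<close>

lemma brunn_minkowski_multiplicative:
  fixes A B C :: "'a::euclidean_space set"
  assumes A: "A \<in> fmeasurable lborel" and B: "B \<in> fmeasurable lborel" and C: "C \<in> fmeasurable lborel"
    and u: "0 < u" "u < 1"
    and sum: "\<And>a b. a \<in> A \<Longrightarrow> b \<in> B \<Longrightarrow> u *\<^sub>R a + (1 - u) *\<^sub>R b \<in> C"
  shows "geom_mean u (measure lebesgue A) (measure lebesgue B) \<le> measure lebesgue C"
proof -
  have [measurable]: "A \<in> sets borel" "B \<in> sets borel" "C \<in> sets borel"
    using A B C by (auto simp: fmeasurable_def)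
  have *: "(\<integral>\<^sup>+x. indicator X x \<partial>lborel) = ennreal (measure lborel X)" if "X \<in> fmeasurable lborel" for X :: "'a set"
    using that by (simp add: fmeasurable_def emeasure_eq_ennreal_measure top.not_eq_extremum)
  have "ennreal_geom_mean u (\<integral>\<^sup>+x. indicator A x \<partial>lborel) (\<integral>\<^sup>+x. indicator B x \<partial>lborel) \<le> (\<integral>\<^sup>+x. indicator C x \<partial>lborel)"
  proof (rule prekopa_leindler[OF u])
    fix x y
    show "ennreal_geom_mean u (indicator A x) (indicator B y) \<le> indicator C (u *\<^sub>R x + (1 - u) *\<^sub>R y)"
      using sum[of x y] by (auto simp: indicator_def ennreal_geom_mean_def geom_mean_same)
  qed simp_all
  thus ?thesis unfolding *[OF A] *[OF B] *[OF C] ennreal_geom_mean_def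
    by (simp add: measure_lebesgue_eq_lborel)
qed

text \<open>Scaling \<open>A\<close> and \<open>B\<close> to unit volume turns the multiplicative
  form into the additive one, by homogeneity of volume.\<close>

theorem brunn_minkowski:
  fixes A B C :: "'a::euclidean_space set"
  assumes A: "A \<in> fmeasurable lborel" "A \<noteq> {}" and B: "B \<in> fmeasurable lborel" "B \<noteq> {}" and C: "C \<in> fmeasurable lborel"
    and sum: "\<And>a b. a \<in> A \<Longrightarrow> b \<in> B \<Longrightarrow> a + b \<in> C"
  shows "root DIM('a) (measure lebesgue A) + root DIM('a) (measure lebesgue B) \<le> root DIM('a) (measure lebesgue C)"
proof -
  define n where "n = DIM('a)"
  have n: "n > 0" by (simp add: n_def)
  have mono: "measure lebesgue X \<le> measure lebesgue C"
    if "X \<in> fmeasurable lborel" "(\<lambda>x. 1 *\<^sub>R x + c) ` X \<subseteq> C" for X c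
  proof -
    have "measure lebesgue X = measure lebesgue ((\<lambda>x. 1 *\<^sub>R x + c) ` X)"
      by (simp only: measure_lebesgue_affine) simp
    also have "\<dots> \<le> measure lebesgue C"
      using fmeasurable_lborel_affine[OF that(1), of 1 c] that(2) C
      by (intro measure_mono_fmeasurable) (auto simp: fmeasurable_def main_part_sets)
    finally show ?thesis .
  qed
  define k t where "k = root n (measure lebesgue A)" and "t = root n (measure lebesgue B)"
  have kt: "k \<ge> 0" "t \<ge> 0" "k ^ n = measure lebesgue A" "t ^ n = measure lebesgue B"
    using n by (simp_all add: k_def t_def)
  show ?thesis unfolding n_def[symmetric] k_def[symmetric] t_def[symmetric]
  proof (cases "k = 0 \<or> t = 0")
    case True
    obtain a b where ab: "a \<in> A" "b \<in> B" using A B by blast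
    \<comment> \<open>If one set is null, it suffices that \<open>C\<close> contains a translate of
      the other set.\<close>
    have "measure lebesgue A \<le> measure lebesgue C" "measure lebesgue B \<le> measure lebesgue C"
      using ab sum A B by (auto intro!: mono[of A b] mono[of B a] simp: add.commute[of _ a])
    then have "k \<le> root n (measure lebesgue C)" "t \<le> root n (measure lebesgue C)"
      using n by (simp_all add: k_def t_def)
    then show "k + t \<le> root n (measure lebesgue C)" using True by auto
  next
    case False
    then have pos: "k > 0" "t > 0" using kt by auto
    \<comment> \<open>This weight makes u (a / k) + (1 - u) (b / t) equal to (a + b) / (k + t), a
      point of the scaled copy of \<open>C\<close>.\<close>
    define u where "u = k / (k + t)"
    have u: "0 < u" "u < 1" and u': "1 - u = t / (k + t)" using pos by (auto simp: u_def field_simps)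
    let ?s = "\<lambda>r X. (\<lambda>x. (1/r) *\<^sub>R x + 0) ` X :: 'a set"
    have meas: "measure lebesgue (?s r X) = measure lebesgue X / r ^ n" if "r > 0" for r X
      unfolding measure_lebesgue_affine n_def using that by (simp add: power_one_over)
    have "geom_mean u (measure lebesgue (?s k A)) (measure lebesgue (?s t B)) \<le> measure lebesgue (?s (k + t) C)"
    proof (rule brunn_minkowski_multiplicative)
      fix a b assume "a \<in> ?s k A" "b \<in> ?s t B"
      then obtain a' b' where "a' \<in> A" "b' \<in> B" "a = (1/k) *\<^sub>R a'" "b = (1/t) *\<^sub>R b'" by auto
      then show "u *\<^sub>R a + (1 - u) *\<^sub>R b \<in> ?s (k + t) C"
        using sum[of a' b'] pos unfolding u' unfolding u_def by (auto simp: image_iff scaleR_add_right intro!: bexI[of _ "a' + b'"])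
    qed (use pos u A B C in \<open>auto intro!: fmeasurable_lborel_affine simp del: add_0_right\<close>)
    also have "measure lebesgue (?s k A) = 1" unfolding meas[OF pos(1)] kt(3)[symmetric] using pos by simp
    also have "measure lebesgue (?s t B) = 1" unfolding meas[OF pos(2)] kt(4)[symmetric] using pos by simp
    also have "measure lebesgue (?s (k + t) C) = measure lebesgue C / (k + t) ^ n" using pos by (simp only: meas)
    finally have "1 \<le> measure lebesgue C / (k + t) ^ n" by (simp add: geom_mean_same)
    then have "(k + t) ^ n \<le> measure lebesgue C" using pos by (simp add: field_simps)
    then have "root n ((k + t) ^ n) \<le> root n (measure lebesgue C)" using n by simp
    then show "k + t \<le> root n (measure lebesgue C)" using n pos by (simp add: real_root_power_cancel)
  qed
qed

section \<open>An elementary inequality between powers\<close>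

text \<open>The Pythagorean relation is the case of exponent 2; each further factor is at most
  \<open>a\<close> on the left and equal to \<open>a\<close> on the right.\<close>

lemma power_add_le_power:
  fixes a b c :: real
  assumes "0 \<le> b" "0 \<le> c" "0 \<le> a" "a\<^sup>2 = b\<^sup>2 + c\<^sup>2"
  shows "b ^ (m + 2) + c ^ (m + 2) \<le> a ^ (m + 2)"
proof (induction m)
  case 0
  then show ?case using assms by (simp add: power2_eq_square)
next
  case (Suc m)
  have "b\<^sup>2 \<le> a\<^sup>2" "c\<^sup>2 \<le> a\<^sup>2" using assms(4) by simp_all
  then have "b \<le> a" "c \<le> a" using assms(3) power2_le_imp_le by blast+
  then have "b * b ^ (m + 2) + c * c ^ (m + 2) \<le> a * b ^ (m + 2) + a * c ^ (m + 2)"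
    using assms by (intro add_mono mult_right_mono) auto
  also have "\<dots> \<le> a * a ^ (m + 2)"
    using Suc assms by (simp flip: distrib_left) (intro mult_left_mono, auto)
  finally show ?case by simp
qed

text \<open>Both legs are strictly shorter than the hypotenuse, so one factor beyond exponent 2
  already makes the inequality strict.\<close>

lemma power_add_less_power:
  fixes a b c :: real
  assumes "0 < b" "0 < c" "0 \<le> a" "a\<^sup>2 = b\<^sup>2 + c\<^sup>2"
  shows "b ^ (m + 3) + c ^ (m + 3) < a ^ (m + 3)"
proof -
  have "b\<^sup>2 < a\<^sup>2" "c\<^sup>2 < a\<^sup>2" using assms by auto
  then have "b < a" "c < a" using assms by (auto intro: power2_less_imp_less)
  then have "b * b ^ (m + 2) + c * c ^ (m + 2) < a * b ^ (m + 2) + a * c ^ (m + 2)"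
    using assms by (intro add_strict_mono mult_strict_right_mono) auto
  also have "\<dots> \<le> a * a ^ (m + 2)"
    using power_add_le_power[of b c a m] assms by (simp flip: distrib_left) (intro mult_left_mono, auto)
  finally show ?thesis by (simp add: numeral_3_eq_3)
qed

text \<open>The numbers k - t, 2 sqrt(k t) and k + t are the sides of a right triangle, and the nth
  power of 2 sqrt(k t) is the left-hand side. Strictness from exponent 3 on is what singles out the
  plane.\<close>

lemma difference_of_powers_ge:
  fixes k t :: real
  assumes "0 \<le> t" "t \<le> k" "2 \<le> n"
  shows "2 ^ n * sqrt (k ^ n * t ^ n) \<le> (k + t) ^ n - (k - t) ^ n"
    and "2 ^ n * sqrt (k ^ n * t ^ n) = (k + t) ^ n - (k - t) ^ n \<Longrightarrow> 3 \<le> n \<Longrightarrow> 0 < t \<Longrightarrow> t = k"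
proof -
  have sq: "(k + t)\<^sup>2 = (k - t)\<^sup>2 + (2 * sqrt (k * t))\<^sup>2"
    using assms by (simp add: power_mult_distrib) (simp add: power2_eq_square algebra_simps)
  have e: "2 ^ n * sqrt (k ^ n * t ^ n) = (2 * sqrt (k * t)) ^ n"
    by (simp add: power_mult_distrib real_sqrt_power[symmetric] real_sqrt_mult[symmetric])
  obtain m where m: "n = m + 2" using assms by (metis le_Suc_ex add.commute)
  show "2 ^ n * sqrt (k ^ n * t ^ n) \<le> (k + t) ^ n - (k - t) ^ n"
  proof -
    have "(k - t) ^ n + (2 * sqrt (k * t)) ^ n \<le> (k + t) ^ n"
      unfolding m by (rule power_add_le_power[OF _ _ _ sq]) (use assms in auto)
    then show ?thesis unfolding e by linarith
  qed
  assume eq: "2 ^ n * sqrt (k ^ n * t ^ n) = (k + t) ^ n - (k - t) ^ n" and n: "3 \<le> n" and t: "0 < t"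
  obtain m' where m': "n = m' + 3" using n by (metis le_Suc_ex add.commute)
  show "t = k"
  proof (rule ccontr)
    assume "t \<noteq> k"
    have "(k - t) ^ n + (2 * sqrt (k * t)) ^ n < (k + t) ^ n"
      unfolding m' by (rule power_add_less_power[OF _ _ _ sq]) (use assms t \<open>t \<noteq> k\<close> in auto)
    then show False using eq unfolding e by linarith
  qed
qed

section \<open>Sums of connected boundaries\<close>

text \<open>A connected boundary that misses the other boundary lies wholly inside or wholly outside
  the other set. The two mixed cases give the nesting; the two symmetric ones would make the
  intersection or the union both compact and open, hence empty.\<close>

lemma frontier_disjoint_cases:
  fixes A B :: "'a::euclidean_space set"
  assumes "compact A" "compact B" "connected (frontier A)" "connected (frontier B)"
    and dis: "frontier A \<inter> frontier B = {}" and AB: "A \<inter> B \<noteq> {}"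
  shows "A \<subseteq> interior B \<or> B \<subseteq> interior A"
proof -
  \<comment> \<open>The part of \<open>A\<close> outside \<open>interior B\<close> equals
    \<open>interior A - B\<close>, so it is compact and open at once and must be empty.\<close>
  have nested: "A \<subseteq> interior B"
    if "compact A" "compact B" "frontier A \<subseteq> B" "frontier B \<inter> A = {}" for A B :: "'a set"
  proof -
    have fr: "frontier A = A - interior A" "frontier B = B - interior B"
      using that by (auto simp: frontier_def compact_imp_closed)
    have "A - interior B = interior A - B"
      using that(3,4) fr interior_subset by blast
    moreover have "compact (A - interior B)" "open (interior A - B)"
      using that by (auto intro: compact_diff open_Diff compact_imp_closed)
    ultimately have "A - interior B = {}" by (metis compact_open)
    then show ?thesis by blast
  qed
  have fr: "frontier A = A - interior A" "frontier B = B - interior B"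
    using assms by (auto simp: frontier_def compact_imp_closed)
  have 1: "frontier A \<subseteq> B \<or> frontier A \<inter> B = {}"
    using connected_Int_frontier[OF assms(3), of B] dis by blast
  have 2: "frontier B \<subseteq> A \<or> frontier B \<inter> A = {}"
    using connected_Int_frontier[OF assms(4), of A] dis by blast
  consider "frontier A \<inter> B = {}" "frontier B \<inter> A = {}" | "frontier A \<subseteq> B" "frontier B \<subseteq> A"
    | "frontier A \<subseteq> B" "frontier B \<inter> A = {}" | "frontier B \<subseteq> A" "frontier A \<inter> B = {}"
    using 1 2 by blast
  then show ?thesis
  proof cases
    case 1
    have "A \<inter> B = interior A \<inter> interior B" using 1 fr interior_subset by blast
    moreover have "compact (A \<inter> B)" using assms by (simp add: compact_Int)
    ultimately have "A \<inter> B = {}" by (metis compact_open open_Int open_interior)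
    then show ?thesis using AB by blast
  next
    case 2
    have "A \<union> B = interior A \<union> interior B" using 2 fr dis interior_subset by blast
    moreover have "compact (A \<union> B)" using assms by (simp add: compact_Un)
    ultimately have "A \<union> B = {}" by (metis compact_open open_Un open_interior)
    then show ?thesis using AB by blast
  next
    case 3
    then show ?thesis using nested assms by blast
  next
    case 4
    then show ?thesis using nested assms by blast
  qed
qed

text \<open>A nonempty compact set is not open, so \<open>interior B - A\<close> is a nonempty open
  set and has positive volume.\<close>

lemma measure_less_of_subset_interior:
  fixes A B :: "'a::euclidean_space set"
  assumes "compact A" "A \<noteq> {}" "A \<subseteq> interior B" "B \<in> lmeasurable"
  shows "measure lebesgue A < measure lebesgue B"
proof -
  have "interior B \<noteq> A" using assms compact_open open_interior by metis
  then have ne: "interior B - A \<noteq> {}" using assms by blast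
  have op: "open (interior B - A)" using assms by (auto intro: open_Diff compact_imp_closed)
  have Am: "A \<in> lmeasurable" using assms lmeasurable_compact by blast
  have BA: "B - A \<in> lmeasurable" using assms Am by (simp add: fmeasurable_Diff fmeasurableD)
  have "\<not> negligible (B - A)"
  proof
    assume "negligible (B - A)"
    then have "negligible (interior B - A)" by (rule negligible_subset) (use interior_subset in blast)
    then show False using open_not_negligible[OF op ne] by blast
  qed
  then have "0 < measure lebesgue (B - A)"
    using BA by (metis measure_nonneg negligible_iff_measure order_le_less)
  moreover have "measure lebesgue (B - A) = measure lebesgue B - measure lebesgue A"
    using assms Am interior_subset by (intro measurable_measure_Diff) (auto simp: fmeasurableD)
  ultimately show ?thesis by simp
qed

section \<open>Reflections and Minkowski sums of compact sets\<close>

lemma reflection_image: "(\<lambda>x. z - x) ` S = (+) z ` uminus ` (S :: 'a::ab_group_add set)"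
  by (simp add: image_image)

lemma measure_reflection: "measure lebesgue ((\<lambda>x. z - x) ` S) = measure lebesgue S"
  for S :: "'a::euclidean_space set"
  using measure_lebesgue_affine[of "-1" z S] by simp

lemma interior_reflection: "interior ((\<lambda>x. z - x) ` S) = (\<lambda>x. z - x) ` interior S"
  for S :: "'a::euclidean_space set"
  unfolding reflection_image by (simp add: interior_translation interior_negations)

lemma compact_reflection: "compact S \<Longrightarrow> compact ((\<lambda>x. z - x) ` S)"
  for S :: "'a::euclidean_space set"
  by (intro compact_continuous_image continuous_intros)

lemma frontier_reflection: "compact S \<Longrightarrow> frontier ((\<lambda>x. z - x) ` S) = (\<lambda>x. z - x) ` frontier S"
  for S :: "'a::euclidean_space set"
  using compact_reflection[of S z]
  by (auto simp: frontier_def compact_imp_closed interior_reflection)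

lemma compact_set_plus:
  fixes A B :: "'a::euclidean_space set"
  assumes "compact A" "compact B"
  shows "compact (A + B)"
proof -
  have "A + B = {x + y |x y. x \<in> A \<and> y \<in> B}" by (auto simp: set_plus_def)
  then show ?thesis using compact_sums[OF assms] by simp
qed

text \<open>Outside of \<open>frontier K + frontier T\<close> the boundaries of \<open>K\<close> and \<open>z - T\<close> are disjoint, so one of these
  sets lies in the interior of the other.\<close>

lemma set_plus_minus_frontiers:
  fixes K T :: "'a::euclidean_space set"
  assumes "compact K" "compact T" "connected (frontier K)" "connected (frontier T)"
    and vol: "measure lebesgue T \<le> measure lebesgue K"
    and z: "z \<in> K + T" "z \<notin> frontier K + frontier T" and t: "t \<in> T"
  shows "z - t \<in> interior K"
proof -
  let ?T = "(\<lambda>x. z - x) ` T"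
  have cT: "compact ?T" by (rule compact_reflection[OF assms(2)])
  have "frontier K \<inter> frontier ?T = {}"
    unfolding frontier_reflection[OF assms(2)] using z(2) set_plus_intro[of "z - _" "frontier K"] by force
  moreover have "connected (frontier ?T)"
    unfolding frontier_reflection[OF assms(2)] using assms
    by (intro connected_continuous_image continuous_intros)
  moreover have "K \<inter> ?T \<noteq> {}"
  proof -
    obtain a b where "a \<in> K" "b \<in> T" "z = a + b" using z(1) by (auto simp: set_plus_def)
    then have "a \<in> K \<inter> ?T" by (auto simp: image_iff algebra_simps intro!: bexI[of _ b])
    then show ?thesis by blast
  qed
  ultimately consider "K \<subseteq> interior ?T" | "?T \<subseteq> interior K"
    using frontier_disjoint_cases[OF assms(1) cT assms(3)] by blast
  then show ?thesis
  proof cases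
    case 1
    have "K \<noteq> {}" using z(1) by (auto simp: set_plus_def)
    from measure_less_of_subset_interior[OF assms(1) this 1] have False
      using cT vol by (simp add: lmeasurable_compact measure_reflection)
    then show ?thesis ..
  next
    case 2
    then show ?thesis using t by blast
  qed
qed

section \<open>Volume bounds for the sum of the boundaries\<close>

text \<open>All sets involved come from compact ones, so volumes subtract. The two bounds are
  Brunn-Minkowski for \<open>K\<close> with \<open>T\<close>, and for
  \<open>K + T - (frontier K + frontier T)\<close> with \<open>- T\<close>, whose sum stays inside
  \<open>K\<close>.\<close>

lemma frontier_sum_volumes:
  fixes K T :: "'a::euclidean_space set"
  assumes K: "compact K" "K \<noteq> {}" "connected (frontier K)"
    and T: "compact T" "T \<noteq> {}" "connected (frontier T)"
    and vol: "measure lebesgue T \<le> measure lebesgue K"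
  defines "k \<equiv> root DIM('a) (measure lebesgue K)" and "t \<equiv> root DIM('a) (measure lebesgue T)"
  shows "measure lebesgue (frontier K + frontier T) = measure lebesgue (K + T) - measure lebesgue (K + T - (frontier K + frontier T))"
    and "k + t \<le> root DIM('a) (measure lebesgue (K + T))"
    and "root DIM('a) (measure lebesgue (K + T - (frontier K + frontier T))) \<le> k - t"
proof -
  let ?F = "frontier K + frontier T"
  have cKT: "compact (K + T)" using K T by (simp add: compact_set_plus)
  have cF: "compact ?F" using K T by (intro compact_set_plus compact_frontier)
  have FKT: "?F \<subseteq> K + T"
    using K T by (intro set_plus_mono2 frontier_subset_compact)
  have m: "measure lebesgue (K + T - ?F) = measure lebesgue (K + T) - measure lebesgue ?F"
    using cKT cF FKT by (intro measurable_measure_Diff) (auto simp: lmeasurable_compact fmeasurableD)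
  then show "measure lebesgue ?F = measure lebesgue (K + T) - measure lebesgue (K + T - ?F)" by simp
  show "k + t \<le> root DIM('a) (measure lebesgue (K + T))"
    unfolding k_def t_def using K T cKT
    by (intro brunn_minkowski) (auto intro: fmeasurable_compact)
  have tk: "t \<le> k" unfolding k_def t_def using vol by simp
  show "root DIM('a) (measure lebesgue (K + T - ?F)) \<le> k - t"
  \<comment> \<open>Brunn-Minkowski requires nonempty sets; for the empty set the claim is just t
    \<le> k.\<close>
  proof (cases "K + T - ?F = {}")
    case True
    show ?thesis unfolding True using tk by simp
  next
    case False
    have "root DIM('a) (measure lebesgue (K + T - ?F)) + root DIM('a) (measure lebesgue ((\<lambda>x. 0 - x) ` T))
        \<le> root DIM('a) (measure lebesgue K)"
    proof (rule brunn_minkowski)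
      show "K + T - ?F \<in> fmeasurable lborel"
        using cKT cF by (intro fmeasurable_Diff) (auto intro: fmeasurable_compact borel_compact)
      fix a b assume "a \<in> K + T - ?F" "b \<in> (\<lambda>x. 0 - x) ` T"
      then show "a + b \<in> K"
        using set_plus_minus_frontiers[OF K(1) T(1) K(3) T(3) vol, of a "- b"] interior_subset[of K] by auto
    qed (use K T False compact_reflection[OF T(1), of 0] in \<open>auto intro: fmeasurable_compact\<close>)
    then show ?thesis unfolding measure_reflection k_def t_def by simp
  qed
qed

lemma minkowski_average_commute: "minkowski_average A B = minkowski_average B A"
  by (simp add: minkowski_average_def add.commute)

lemma measure_minkowski_average:
  fixes A B :: "'a::euclidean_space set"
  shows "measure lebesgue (minkowski_average A B) = measure lebesgue (A + B) / 2 ^ DIM('a)"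
  using measure_lebesgue_affine[of "1/2" 0 "A + B"] by (simp add: minkowski_average_def power_one_over)

lemma frontier_sum_lower_bound:
  fixes K T :: "'a::euclidean_space set"
  assumes K: "compact K" "K \<noteq> {}" "connected (frontier K)"
    and T: "compact T" "T \<noteq> {}" "connected (frontier T)"
    and vol: "measure lebesgue T \<le> measure lebesgue K" and dim: "2 \<le> DIM('a)"
  shows "measure lebesgue (minkowski_average (frontier K) (frontier T)) \<ge> sqrt (measure lebesgue K * measure lebesgue T)"
proof -
  define n where "n = DIM('a)"
  have n: "0 < n" "2 \<le> n" using dim by (simp_all add: n_def)
  define k t where "k = root n (measure lebesgue K)" and "t = root n (measure lebesgue T)"
  have kt: "0 \<le> t" "t \<le> k" "k ^ n = measure lebesgue K" "t ^ n = measure lebesgue T"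
    using n vol by (simp_all add: k_def t_def)
  note fv = frontier_sum_volumes[OF K T vol, folded n_def, folded k_def t_def]
  have "(k + t) ^ n \<le> measure lebesgue (K + T)"
    using power_mono[OF fv(2), of n] kt n by simp
  moreover have "measure lebesgue (K + T - (frontier K + frontier T)) \<le> (k - t) ^ n"
    using power_mono[OF fv(3), of n] kt n by simp
  ultimately have "(k + t) ^ n - (k - t) ^ n \<le> measure lebesgue (frontier K + frontier T)"
    using fv(1) by simp
  with difference_of_powers_ge(1)[OF kt(1,2) n(2)]
  have "2 ^ n * sqrt (k ^ n * t ^ n) \<le> measure lebesgue (frontier K + frontier T)" by linarith
  moreover have "measure lebesgue (minkowski_average (frontier K) (frontier T)) = measure lebesgue (frontier K + frontier T) / 2 ^ n"
    by (simp add: measure_minkowski_average n_def)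
  ultimately have "2 ^ n * sqrt (measure lebesgue K * measure lebesgue T)
      \<le> 2 ^ n * measure lebesgue (minkowski_average (frontier K) (frontier T))"
    using kt by simp
  then show ?thesis by (rule mult_left_le_imp_le) simp
qed

section \<open>Equality in the Brunn-Minkowski inequality\<close>

text \<open>Summing the hypothesis over a partition into steps of length h telescopes to a
  comparison in which the interval for \<open>R\<close> is shifted left by h. The shift disappears
  as h tends to 0, by continuity of \<open>R\<close>.\<close>

lemma increments_le:
  fixes R S :: "real \<Rightarrow> real"
  assumes cont: "continuous_on {..0} R"
    and inc: "\<And>x h. 0 < h \<Longrightarrow> x + h \<le> 0 \<Longrightarrow> R x - R (x - h) \<le> S (x + h) - S x"
    and xy: "x < y" "y \<le> 0"
  shows "R y - R x \<le> S y - S x"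
proof -
  define h where "h N = (y - x) / real (Suc N)" for N
  have h: "h N > 0" for N using xy by (simp add: h_def)
  have "R (y - h N) - R (x - h N) \<le> S y - S x" for N
  proof -
    let ?h = "h N"
    have y: "y = x + real (Suc N) * ?h" by (simp add: h_def)
    have "(\<Sum>i<Suc N. R (x + real (Suc i) * ?h - ?h) - R (x + real i * ?h - ?h))
       \<le> (\<Sum>i<Suc N. S (x + real (Suc i) * ?h) - S (x + real i * ?h))"
    proof (intro sum_mono)
      fix i assume "i \<in> {..<Suc N}"
      then have "real (Suc i) * ?h \<le> real (Suc N) * ?h"
        using h[of N] by (intro mult_right_mono) auto
      then have "x + real i * ?h + ?h \<le> 0" using y xy by (simp add: algebra_simps)
      from inc[OF h this]
      show "R (x + real (Suc i) * ?h - ?h) - R (x + real i * ?h - ?h) \<le> S (x + real (Suc i) * ?h) - S (x + real i * ?h)"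
        by (simp add: algebra_simps)
    qed
    also have "(\<Sum>i<Suc N. R (x + real (Suc i) * ?h - ?h) - R (x + real i * ?h - ?h)) = R (y - ?h) - R (x - ?h)"
      using sum_lessThan_telescope[of "\<lambda>i. R (x + real i * ?h - ?h)" "Suc N"] y by simp
    also have "(\<Sum>i<Suc N. S (x + real (Suc i) * ?h) - S (x + real i * ?h)) = S y - S x"
      using sum_lessThan_telescope[of "\<lambda>i. S (x + real i * ?h)" "Suc N"] y by simp
    finally show ?thesis .
  qed
  moreover have "(\<lambda>N. R (y - h N) - R (x - h N)) \<longlonglongrightarrow> R y - R x"
  proof -
    have h0: "h \<longlonglongrightarrow> 0" unfolding h_def by real_asymp
    have "(\<lambda>N. R (z - h N)) \<longlonglongrightarrow> R z" if "z \<le> 0" for z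
    proof (rule continuous_on_tendsto_compose[OF cont])
      show "(\<lambda>N. z - h N) \<longlonglongrightarrow> z" using tendsto_diff[OF tendsto_const h0, of z] by simp
      show "\<forall>\<^sub>F N in sequentially. z - h N \<in> {..0}"
        using h[THEN less_imp_le] that by (auto intro!: always_eventually intro: order_trans)
    qed (use that in auto)
    then show ?thesis using xy by (intro tendsto_diff) auto
  qed
  ultimately show ?thesis by (intro LIMSEQ_le_const2) auto
qed

text \<open>Strict monotonicity makes \<open>F\<close> injective, the intermediate value theorem
  makes it onto [0, 1], and the inverse of a continuous injection on a compact interval is
  continuous.\<close>

lemma quantile_function:
  fixes F :: "real \<Rightarrow> real"
  assumes cont: "continuous_on {m..M} F" and mono: "\<And>s t. m \<le> s \<Longrightarrow> s < t \<Longrightarrow> t \<le> M \<Longrightarrow> F s < F t"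
    and F: "F m = 0" "F M = 1" and mM: "m \<le> M"
  obtains q where "continuous_on {0..1} q" "\<And>p. 0 \<le> p \<Longrightarrow> p \<le> 1 \<Longrightarrow> F (q p) = p"
    "\<And>p. 0 \<le> p \<Longrightarrow> p \<le> 1 \<Longrightarrow> m \<le> q p \<and> q p \<le> M" "\<And>s. m \<le> s \<Longrightarrow> s \<le> M \<Longrightarrow> q (F s) = s"
proof -
  define q where "q = inv_into {m..M} F"
  have inj: "inj_on F {m..M}"
    by (rule linorder_inj_onI) (use mono in \<open>force+\<close>)
  have le: "F s \<le> F t" if "m \<le> s" "s \<le> t" "t \<le> M" for s t
    using mono[of s t] that by (cases "s = t") auto
  have img: "F ` {m..M} = {0..1}"
  proof
    show "F ` {m..M} \<subseteq> {0..1}" using le[of m] le[of _ M] F by auto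
    show "{0..1} \<subseteq> F ` {m..M}"
    proof
      fix p :: real assume "p \<in> {0..1}"
      then obtain x where "m \<le> x" "x \<le> M" "F x = p"
        using IVT'[of F m p M] F mM cont by auto
      then show "p \<in> F ` {m..M}" by auto
    qed
  qed
  have "continuous_on (F ` {m..M}) q"
    by (rule continuous_on_inv[OF cont]) (use inj in \<open>auto simp: q_def\<close>)
  then have "continuous_on {0..1} q" unfolding img .
  moreover have "F (q p) = p" "q p \<in> {m..M}" if "0 \<le> p" "p \<le> 1" for p
    using that img f_inv_into_f[of p F "{m..M}"] inv_into_into[of p F "{m..M}"] by (auto simp: q_def)
  moreover have "q (F s) = s" if "m \<le> s" "s \<le> M" for s
    using that inj by (simp add: q_def)
  ultimately show ?thesis by (intro that[of q]) auto
qed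

section \<open>Volumes cut off by half-spaces\<close>

text \<open>For a compact \<open>K\<close> of volume 1 this is the distribution function of
  \<open>u \<bullet> x\<close> with x uniformly distributed in \<open>K\<close>.\<close>

definition halfspace_volume :: "'a::euclidean_space set \<Rightarrow> 'a \<Rightarrow> real \<Rightarrow> real" where
  "halfspace_volume K u s = measure lebesgue (K \<inter> {x. u \<bullet> x \<le> s})"

lemma compact_Int_halfspace:
  fixes K :: "'a::euclidean_space set"
  assumes "compact K"
  shows "compact (K \<inter> {x. u \<bullet> x \<le> s})" "compact (K \<inter> {x. u \<bullet> x \<ge> s})"
  using assms by (auto intro: compact_Int_closed closed_halfspace_le closed_halfspace_ge)

lemma measure_halfspaces:
  fixes K :: "'a::euclidean_space set"
  assumes "compact K" "u \<noteq> 0"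
  shows "measure lebesgue (K \<inter> {x. u \<bullet> x \<ge> s}) = measure lebesgue K - halfspace_volume K u s"
proof -
  let ?A = "K \<inter> {x. u \<bullet> x \<le> s}" and ?B = "K \<inter> {x. u \<bullet> x \<ge> s}"
  have "negligible (?A \<inter> ?B)"
    by (rule negligible_subset[OF negligible_hyperplane[of u s]]) (use assms in auto)
  then have "measure lebesgue (?A \<union> ?B) = measure lebesgue ?A + measure lebesgue ?B"
    using compact_Int_halfspace[OF assms(1)]
    by (simp add: measure_Un3 lmeasurable_compact negligible_imp_measure0)
  moreover have "?A \<union> ?B = K" by auto
  ultimately show ?thesis by (simp add: halfspace_volume_def)
qed

text \<open>Viewing the volumes as a probability distribution gives access to the theory of
  distribution functions: monotonicity, continuity, uniqueness and means.\<close>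

definition direction_distr :: "'a::euclidean_space set \<Rightarrow> 'a \<Rightarrow> real measure" where
  "direction_distr K u = distr (uniform_measure lborel K) borel (\<lambda>x. u \<bullet> x)"

context
  fixes K :: "'a::euclidean_space set"
  assumes K: "compact K" "measure lebesgue K = 1"
begin

lemma emeasure_lborel_eq_1: "emeasure lborel K = 1"
  using K by (metis borel_compact ennreal_1 emeasure_eq_measure2 fmeasurable_compact measure_lebesgue_eq_lborel)

lemma prob_space_uniform: "prob_space (uniform_measure lborel K)"
  by (rule prob_space_uniform_measure) (simp_all add: emeasure_lborel_eq_1)

lemma real_distribution_direction: "real_distribution (direction_distr K u)"
proof -
  interpret prob_space "uniform_measure lborel K" by (rule prob_space_uniform)
  show ?thesis unfolding direction_distr_def by (rule real_distribution_distr) simp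
qed

lemma cdf_direction: "cdf (direction_distr K u) = halfspace_volume K u"
proof
  fix s
  have [measurable]: "K \<in> sets borel" using K by (simp add: borel_compact)
  have "cdf (direction_distr K u) s = measure (uniform_measure lborel K) ((\<lambda>x. u \<bullet> x) -` {..s})"
    unfolding cdf_def direction_distr_def by (subst measure_distr) auto
  also have "(\<lambda>x. u \<bullet> x) -` {..s} = {x. u \<bullet> x \<le> s}" by auto
  also have "measure (uniform_measure lborel K) {x. u \<bullet> x \<le> s} = measure lborel (K \<inter> {x. u \<bullet> x \<le> s})"
    by (subst measure_uniform_measure) (simp_all add: emeasure_lborel_eq_1 measure_def)
  also have "\<dots> = halfspace_volume K u s"
    unfolding halfspace_volume_def by (rule measure_lebesgue_eq_lborel[symmetric]) simp
  finally show "cdf (direction_distr K u) s = halfspace_volume K u s" .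
qed

lemma halfspace_volume_mono: "s \<le> t \<Longrightarrow> halfspace_volume K u s \<le> halfspace_volume K u t"
proof -
  interpret real_distribution "direction_distr K u" by (rule real_distribution_direction)
  show "s \<le> t \<Longrightarrow> halfspace_volume K u s \<le> halfspace_volume K u t"
    using cdf_nondecreasing[of s t] by (simp add: cdf_direction)
qed

lemma halfspace_volume_bounds: "0 \<le> halfspace_volume K u s" "halfspace_volume K u s \<le> 1"
proof -
  interpret real_distribution "direction_distr K u" by (rule real_distribution_direction)
  show "0 \<le> halfspace_volume K u s" "halfspace_volume K u s \<le> 1"
    using cdf_nonneg[of s] cdf_bounded_prob[of s] by (simp_all add: cdf_direction)
qed

text \<open>A jump of the distribution function would be an atom, that is, a hyperplane section of
  positive volume.\<close>

lemma isCont_halfspace_volume: "u \<noteq> 0 \<Longrightarrow> isCont (halfspace_volume K u) s"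
proof -
  assume u: "u \<noteq> 0"
  interpret real_distribution "direction_distr K u" by (rule real_distribution_direction)
  have [measurable]: "K \<in> sets borel" using K by (simp add: borel_compact)
  have "measure (direction_distr K u) {s} = measure (uniform_measure lborel K) ((\<lambda>x. u \<bullet> x) -` {s})"
    unfolding direction_distr_def by (subst measure_distr) auto
  also have "(\<lambda>x. u \<bullet> x) -` {s} = {x. u \<bullet> x = s}" by auto
  also have "measure (uniform_measure lborel K) {x. u \<bullet> x = s} = measure lborel (K \<inter> {x. u \<bullet> x = s})"
    by (subst measure_uniform_measure) (simp_all add: emeasure_lborel_eq_1 measure_def)
  also have "\<dots> = measure lebesgue (K \<inter> {x. u \<bullet> x = s})"
    by (rule measure_lebesgue_eq_lborel[symmetric]) simp
  also have "\<dots> = 0"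
    by (intro negligible_imp_measure0 negligible_subset[OF negligible_hyperplane[of u s]]) (use u in auto)
  finally show ?thesis unfolding cdf_direction[symmetric] isCont_cdf .
qed

text \<open>\<open>K\<close> is bounded, so the uniform distribution has a mean, the centroid. That
  the mean in direction \<open>u\<close> is linear in \<open>u\<close> later identifies one
  translation vector for all directions.\<close>

lemma expectation_direction:
  "(\<integral>x. x \<partial>direction_distr K u) = u \<bullet> (\<integral>x. x \<partial>uniform_measure lborel K)"
    "integrable (direction_distr K u) (\<lambda>x. x)"
proof -
  interpret U: prob_space "uniform_measure lborel K" by (rule prob_space_uniform)
  obtain B where B: "\<And>x. x \<in> K \<Longrightarrow> norm x \<le> B" using compact_imp_bounded[OF K(1)] by (auto simp: bounded_iff)
  have [measurable]: "K \<in> sets lborel" using K by (simp add: borel_compact)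
  have "AE x in uniform_measure lborel K. norm x \<le> B"
    by (rule AE_uniform_measureI) (use B K borel_compact in auto)
  then have int: "integrable (uniform_measure lborel K) (\<lambda>x. x)"
    by (intro U.integrable_const_bound) auto
  have "(\<integral>x. x \<partial>direction_distr K u) = (\<integral>x. u \<bullet> x \<partial>uniform_measure lborel K)"
    unfolding direction_distr_def by (subst integral_distr) auto
  also have "\<dots> = u \<bullet> (\<integral>x. x \<partial>uniform_measure lborel K)"
    using int by (intro integral_inner_right)
  finally show "(\<integral>x. x \<partial>direction_distr K u) = u \<bullet> (\<integral>x. x \<partial>uniform_measure lborel K)" .
  show "integrable (direction_distr K u) (\<lambda>x. x)"
    unfolding direction_distr_def using int by (subst integrable_distr_eq) auto
qed

lemma halfspace_volume_eq_1: "(\<And>x. x \<in> K \<Longrightarrow> u \<bullet> x \<le> s) \<Longrightarrow> halfspace_volume K u s = 1"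
proof -
  assume "\<And>x. x \<in> K \<Longrightarrow> u \<bullet> x \<le> s"
  then have "K \<inter> {x. u \<bullet> x \<le> s} = K" by auto
  then show ?thesis using K by (simp add: halfspace_volume_def)
qed

lemma halfspace_volume_eq_0: "u \<noteq> 0 \<Longrightarrow> (\<And>x. x \<in> K \<Longrightarrow> s \<le> u \<bullet> x) \<Longrightarrow> halfspace_volume K u s = 0"
proof -
  assume "u \<noteq> 0" "\<And>x. x \<in> K \<Longrightarrow> s \<le> u \<bullet> x"
  moreover from this have "K \<inter> {x. u \<bullet> x \<ge> s} = K" by auto
  ultimately show ?thesis using measure_halfspaces[OF K(1), of u s] K by simp
qed

text \<open>Convexity puts a point of \<open>K\<close> in the open slab between the two levels. This
  point is a limit of interior points, so the slab contains a nonempty open piece of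
  \<open>K\<close>.\<close>

lemma halfspace_volume_strict_mono:
  assumes "convex K" "interior K \<noteq> {}" "x \<in> K" "y \<in> K" "u \<bullet> x \<le> s" "s < t" "t \<le> u \<bullet> y"
  shows "halfspace_volume K u s < halfspace_volume K u t"
proof -
  have "connected ((\<lambda>x. u \<bullet> x) ` K)"
    using assms by (intro connected_continuous_image continuous_intros convex_connected)
  then have "(s + t) / 2 \<in> (\<lambda>x. u \<bullet> x) ` K"
    by (rule connectedD_interval[of _ "u \<bullet> x" "u \<bullet> y"]) (use assms in auto)
  then obtain z where z: "z \<in> K" "u \<bullet> z = (s + t) / 2" by auto
  let ?S = "{x. s < u \<bullet> x} \<inter> {x. u \<bullet> x < t}"
  have op: "open ?S" by (intro open_Int open_halfspace_lt open_halfspace_gt)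
  have "z \<in> closure (interior K)"
    using convex_closure_interior[OF assms(1,2)] z closure_subset by auto
  moreover have "z \<in> ?S" using z assms by auto
  ultimately have ne: "?S \<inter> interior K \<noteq> {}"
    using op by (metis IntI closure_iff_nhds_not_empty inf_commute interior_subset order_refl)
  have neg: "\<not> negligible (?S \<inter> interior K)"
    using open_not_negligible[of "?S \<inter> interior K"] op ne by auto
  let ?A = "K \<inter> {x. u \<bullet> x \<le> s}" and ?B = "K \<inter> {x. u \<bullet> x \<le> t}"
  have m: "?A \<in> lmeasurable" "?B \<in> lmeasurable"
    using compact_Int_halfspace[OF K(1)] by (auto intro: lmeasurable_compact)
  have "\<not> negligible (?B - ?A)"
    using neg negligible_subset[of "?B - ?A" "?S \<inter> interior K"] interior_subset[of K] by force
  then have "0 < measure lebesgue (?B - ?A)"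
    using m by (metis fmeasurable.Diff measure_nonneg negligible_iff_measure order_le_less)
  also have "measure lebesgue (?B - ?A) = measure lebesgue ?B - measure lebesgue ?A"
    using m assms by (intro measurable_measure_Diff) (auto simp: fmeasurableD)
  finally show ?thesis by (simp add: halfspace_volume_def)
qed

end

text \<open>The two complementary pairs of half-spaces cut off the same proportion of \<open>K\<close> and \<open>T\<close>; if the
  mean of \<open>K\<close> and \<open>T\<close> has minimal volume, the Brunn-Minkowski inequality must be an equality for both.\<close>

lemma halfspace_volume_product_le:
  fixes K T :: "'a::euclidean_space set"
  assumes K: "compact K" "measure lebesgue K = 1" and T: "compact T" "measure lebesgue T = 1"
    and M: "measure lebesgue (minkowski_average K T) \<le> 1" and u: "u \<noteq> 0"
    and eq: "halfspace_volume K u s = p" "halfspace_volume T u r = p" and s: "s' + r' = s + r"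
  shows "halfspace_volume K u s' * halfspace_volume T u r' \<le> p\<^sup>2"
proof -
  define M where "M = minkowski_average K T"
  have cM: "compact M" unfolding M_def minkowski_average_def
    by (intro compact_continuous_image continuous_intros compact_set_plus K T)
  have mid: "(1/2) *\<^sub>R a + (1 - 1/2) *\<^sub>R b \<in> M" if "a \<in> K" "b \<in> T" for a b
    using that by (auto simp: M_def minkowski_average_def scaleR_add_right intro!: image_eqI[of _ _ "a + b"])
  define \<tau> where "\<tau> = (s + r) / 2"
  note hs = compact_Int_halfspace
  have in_mid: "u \<bullet> ((1/2) *\<^sub>R a + (1 - 1/2) *\<^sub>R b) = (u \<bullet> a + u \<bullet> b) / 2" for a b :: 'a
    by (simp add: inner_add_right)
  have p: "0 \<le> p" "p \<le> 1" using halfspace_volume_bounds[OF K, of u s] eq by auto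
  \<comment> \<open>The upper parts of \<open>K\<close> and \<open>T\<close> both have volume 1 - p,
    so \<open>M\<close> has at least that much above level \<tau>, and at most p is left
    below.\<close>
  have "geom_mean (1/2) (measure lebesgue (K \<inter> {x. u \<bullet> x \<ge> s})) (measure lebesgue (T \<inter> {x. u \<bullet> x \<ge> r}))
     \<le> measure lebesgue (M \<inter> {x. u \<bullet> x \<ge> \<tau>})"
  proof (rule brunn_minkowski_multiplicative)
    fix a b assume "a \<in> K \<inter> {x. u \<bullet> x \<ge> s}" "b \<in> T \<inter> {x. u \<bullet> x \<ge> r}"
    then show "(1/2) *\<^sub>R a + (1 - 1/2) *\<^sub>R b \<in> M \<inter> {x. u \<bullet> x \<ge> \<tau>}"
      using mid[of a b] by (simp only: in_mid Int_iff mem_Collect_eq \<tau>_def) simp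
  qed (use K T cM in \<open>simp_all add: fmeasurable_compact hs\<close>)
  then have "1 - p \<le> measure lebesgue M - halfspace_volume M u \<tau>"
    unfolding measure_halfspaces[OF K(1) u] measure_halfspaces[OF T(1) u] measure_halfspaces[OF cM u] eq K T
    using p by (simp add: geom_mean_same)
  then have 1: "halfspace_volume M u \<tau> \<le> p" using M unfolding M_def by simp
  \<comment> \<open>Since s' + r' = s + r, means of points below the levels s' and r' again lie
    below \<tau>.\<close>
  have "geom_mean (1/2) (halfspace_volume K u s') (halfspace_volume T u r') \<le> halfspace_volume M u \<tau>"
    unfolding halfspace_volume_def
  proof (rule brunn_minkowski_multiplicative)
    fix a b assume "a \<in> K \<inter> {x. u \<bullet> x \<le> s'}" "b \<in> T \<inter> {x. u \<bullet> x \<le> r'}"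
    then show "(1/2) *\<^sub>R a + (1 - 1/2) *\<^sub>R b \<in> M \<inter> {x. u \<bullet> x \<le> \<tau>}"
      using mid[of a b] s by (simp only: in_mid Int_iff mem_Collect_eq \<tau>_def) simp
  qed (use K T cM in \<open>simp_all add: fmeasurable_compact hs\<close>)
  then have "geom_mean (1/2) (halfspace_volume K u s') (halfspace_volume T u r') \<le> p" using 1 by simp
  then have "(geom_mean (1/2) (halfspace_volume K u s') (halfspace_volume T u r'))\<^sup>2 \<le> p\<^sup>2"
    by (intro power_mono) auto
  then show ?thesis
    using halfspace_volume_bounds[OF K] halfspace_volume_bounds[OF T]
    by (simp add: geom_mean_def powr_half_sqrt power_mult_distrib)
qed

text \<open>The endpoints \<open>m\<close> and \<open>M\<close> are the extreme values of
  \<open>u \<bullet> x\<close> on \<open>K\<close>, between which the half-space volume is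
  continuous and strictly increasing from 0 to 1.\<close>

lemma halfspace_quantile:
  fixes K :: "'a::euclidean_space set"
  assumes K: "compact K" "measure lebesgue K = 1" "convex K" "interior K \<noteq> {}" and u: "u \<noteq> 0"
  obtains q m M where "continuous_on {0..1} q" "\<And>p. 0 \<le> p \<Longrightarrow> p \<le> 1 \<Longrightarrow> halfspace_volume K u (q p) = p"
      "\<And>p. 0 \<le> p \<Longrightarrow> p \<le> 1 \<Longrightarrow> m \<le> q p \<and> q p \<le> M" "\<And>s. m \<le> s \<Longrightarrow> s \<le> M \<Longrightarrow> q (halfspace_volume K u s) = s"
      "\<And>s t. m \<le> s \<Longrightarrow> s < t \<Longrightarrow> t \<le> M \<Longrightarrow> halfspace_volume K u s < halfspace_volume K u t"
      "halfspace_volume K u m = 0" "halfspace_volume K u M = 1" "m \<le> M"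
proof -
  have ne: "K \<noteq> {}" using K by auto
  have cont: "continuous_on K (\<lambda>x. u \<bullet> x)" by (intro continuous_intros)
  obtain a where a: "a \<in> K" "\<And>x. x \<in> K \<Longrightarrow> u \<bullet> a \<le> u \<bullet> x"
    using continuous_attains_inf[OF K(1) ne cont] by blast
  obtain b where b: "b \<in> K" "\<And>x. x \<in> K \<Longrightarrow> u \<bullet> x \<le> u \<bullet> b"
    using continuous_attains_sup[OF K(1) ne cont] by blast
  have strict: "halfspace_volume K u s < halfspace_volume K u t"
    if "u \<bullet> a \<le> s" "s < t" "t \<le> u \<bullet> b" for s t
    using halfspace_volume_strict_mono[OF K a(1) b(1) that] .
  have F: "halfspace_volume K u (u \<bullet> a) = 0" "halfspace_volume K u (u \<bullet> b) = 1"
    using halfspace_volume_eq_0[OF K(1,2) u a(2)] halfspace_volume_eq_1[OF K(1,2) b(2)] by auto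
  have co: "continuous_on {u \<bullet> a..u \<bullet> b} (halfspace_volume K u)"
    using isCont_halfspace_volume[OF K(1,2) u] by (simp add: continuous_at_imp_continuous_on)
  obtain q where "continuous_on {0..1} q" "\<And>p. 0 \<le> p \<Longrightarrow> p \<le> 1 \<Longrightarrow> halfspace_volume K u (q p) = p"
    "\<And>p. 0 \<le> p \<Longrightarrow> p \<le> 1 \<Longrightarrow> u \<bullet> a \<le> q p \<and> q p \<le> u \<bullet> b"
    "\<And>s. u \<bullet> a \<le> s \<Longrightarrow> s \<le> u \<bullet> b \<Longrightarrow> q (halfspace_volume K u s) = s"
    using quantile_function[OF co strict F a(2)[OF b(1)]] by blast
  from that[OF this strict F a(2)[OF b(1)]] show ?thesis .
qed

section \<open>From half-space volumes to translates\<close>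

text \<open>The product bound is symmetric in the two bodies, so it bounds the increments of each
  quantile function by those of the other. The increments agree, and the quantile functions differ
  by a constant.\<close>

lemma halfspace_volume_shift:
  fixes K T :: "'a::euclidean_space set"
  assumes K: "compact K" "measure lebesgue K = 1" "convex K" "interior K \<noteq> {}"
    and T: "compact T" "measure lebesgue T = 1" "convex T" "interior T \<noteq> {}"
    and M: "measure lebesgue (minkowski_average K T) \<le> 1" and u: "u \<noteq> 0"
  obtains c where "\<And>s. halfspace_volume T u (s + c) = halfspace_volume K u s"
proof -
  let ?F = "halfspace_volume K u" and ?G = "halfspace_volume T u"
  obtain q1 m1 M1 where q1: "continuous_on {0..1} q1" "\<And>p. 0 \<le> p \<Longrightarrow> p \<le> 1 \<Longrightarrow> ?F (q1 p) = p"
      "\<And>p. 0 \<le> p \<Longrightarrow> p \<le> 1 \<Longrightarrow> m1 \<le> q1 p \<and> q1 p \<le> M1" "\<And>s. m1 \<le> s \<Longrightarrow> s \<le> M1 \<Longrightarrow> q1 (?F s) = s"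
      "\<And>s t. m1 \<le> s \<Longrightarrow> s < t \<Longrightarrow> t \<le> M1 \<Longrightarrow> ?F s < ?F t" "?F m1 = 0" "?F M1 = 1" "m1 \<le> M1"
    by (fact halfspace_quantile[OF K u])
  obtain q2 m2 M2 where q2: "continuous_on {0..1} q2" "\<And>p. 0 \<le> p \<Longrightarrow> p \<le> 1 \<Longrightarrow> ?G (q2 p) = p"
      "\<And>p. 0 \<le> p \<Longrightarrow> p \<le> 1 \<Longrightarrow> m2 \<le> q2 p \<and> q2 p \<le> M2" "\<And>s. m2 \<le> s \<Longrightarrow> s \<le> M2 \<Longrightarrow> q2 (?G s) = s"
      "\<And>s t. m2 \<le> s \<Longrightarrow> s < t \<Longrightarrow> t \<le> M2 \<Longrightarrow> ?G s < ?G t" "?G m2 = 0" "?G M2 = 1" "m2 \<le> M2"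
    by (fact halfspace_quantile[OF T u])
  \<comment> \<open>In the variable \<open>ln p\<close> the product bound says that increments of one quantile function over
    \<open>[x - h, x]\<close> are at most those of the other one over \<open>[x, x + h]\<close>.\<close>
  define S where "S x = q1 (exp x)" for x
  define R where "R x = q2 (exp x)" for x
  have contS: "continuous_on {..0} S" unfolding S_def
    by (rule continuous_on_compose2[OF q1(1)]) (auto intro!: continuous_intros)
  have contR: "continuous_on {..0} R" unfolding R_def
    by (rule continuous_on_compose2[OF q2(1)]) (auto intro!: continuous_intros)
  \<comment> \<open>General \<open>F\<close> and \<open>G\<close> allow both orders of the bodies.
    If the bound failed, raising the level of \<open>F\<close> to volume exp(x + h) and lowering
    that of \<open>G\<close> by the same amount would leave \<open>G\<close> above exp(x - h), so
    the product would exceed the square of exp x.\<close>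
  have key: "r2 (exp x) - r2 (exp (x - h)) \<le> r1 (exp (x + h)) - r1 (exp x)"
    if h: "0 < h" "x + h \<le> 0"
      and r1: "\<And>p. 0 \<le> p \<Longrightarrow> p \<le> 1 \<Longrightarrow> F (r1 p) = p"
        "\<And>s t. s \<le> t \<Longrightarrow> F s \<le> F t"
      and r2: "\<And>p. 0 \<le> p \<Longrightarrow> p \<le> 1 \<Longrightarrow> G (r2 p) = p" "\<And>p. 0 \<le> p \<Longrightarrow> p \<le> 1 \<Longrightarrow> n \<le> r2 p \<and> r2 p \<le> N"
        "\<And>s t. n \<le> s \<Longrightarrow> s < t \<Longrightarrow> t \<le> N \<Longrightarrow> G s < G t"
      and FG: "\<And>p s r s' r'. F s = p \<Longrightarrow> G r = p \<Longrightarrow> s' + r' = s + r \<Longrightarrow> F s' * G r' \<le> p\<^sup>2"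
    for x h n N :: real and r1 r2 F G :: "real \<Rightarrow> real"
  proof (rule ccontr)
    assume "\<not> ?thesis"
    then have gt: "r1 (exp x) + r2 (exp x) - r1 (exp (x + h)) > r2 (exp (x - h))" (is "?r > _") by simp
    have e: "exp x \<le> 1" "exp (x + h) \<le> 1" "exp (x - h) \<le> 1" using h by auto
    have "F (r1 (exp x)) < F (r1 (exp (x + h)))" using r1(1) e h by simp
    then have "r1 (exp x) \<le> r1 (exp (x + h))" using r1(2) by (meson linorder_not_le nle_le)
    then have "?r \<le> N" using r2(2)[of "exp x"] e by simp
    then have "G (r2 (exp (x - h))) < G ?r" using r2(2)[of "exp (x - h)"] e gt by (intro r2(3)) auto
    then have "exp (x - h) < G ?r" using r2(1) e by simp
    then have "exp (x + h) * exp (x - h) < exp (x + h) * G ?r" by simp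
    also have "\<dots> \<le> (exp x)\<^sup>2"
      using FG[of "r1 (exp x)" "exp x" "r2 (exp x)" "r1 (exp (x + h))" ?r] r1(1) r2(1) e by simp
    also have "(exp x)\<^sup>2 = exp (x + h) * exp (x - h)"
      by (simp add: power2_eq_square flip: exp_add)
    finally show False by simp
  qed
  have prod: "?F s' * ?G r' \<le> p\<^sup>2" if "?F s = p" "?G r = p" "s' + r' = s + r" for p s r s' r'
    by (rule halfspace_volume_product_le[OF K(1,2) T(1,2) M u that])
  have RS: "R x - R (x - h) \<le> S (x + h) - S x" if "0 < h" "x + h \<le> 0" for x h
    unfolding R_def S_def
    by (rule key[where F = ?F and G = ?G and ?r1.0 = q1 and ?r2.0 = q2, OF that q1(2) halfspace_volume_mono[OF K(1,2)] q2(2,3,5)]) (auto intro: prod)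
  have SR: "S x - S (x - h) \<le> R (x + h) - R x" if "0 < h" "x + h \<le> 0" for x h
    unfolding R_def S_def
  proof (rule key[where F = ?G and G = ?F and ?r1.0 = q2 and ?r2.0 = q1, OF that q2(2) halfspace_volume_mono[OF T(1,2)] q1(2,3,5)])
    fix p s r s' r' assume "?G s = p" "?F r = p" "s' + r' = s + r"
    then show "?G s' * ?F r' \<le> p\<^sup>2" using prod[of r p s r' s'] by (simp add: mult.commute add.commute)
  qed
  have M12: "q1 1 = M1" "q2 1 = M2" using q1(4)[of M1] q2(4)[of M2] q1(7,8) q2(7,8) by auto
  \<comment> \<open>The shift is read off at p = 1, which corresponds to the logarithmic variable
    0.\<close>
  define c where "c = M2 - M1"
  have shift: "q2 p = q1 p + c" if "0 < p" "p \<le> 1" for p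
  proof (cases "p = 1")
    case False
    then have "ln p < 0" using that by simp
    then have "R 0 - R (ln p) \<le> S 0 - S (ln p)" "S 0 - S (ln p) \<le> R 0 - R (ln p)"
      using increments_le[OF contR RS, of "ln p" 0] increments_le[OF contS SR, of "ln p" 0] by auto
    then show ?thesis using that by (simp add: R_def S_def M12 c_def)
  qed (simp add: M12 c_def)
  note Fm = halfspace_volume_mono[OF K(1,2)] and Gm = halfspace_volume_mono[OF T(1,2)]
  note Fb = halfspace_volume_bounds[OF K(1,2)] and Gb = halfspace_volume_bounds[OF T(1,2)]
  have "?G (s + c) = ?F s" for s
  proof -
    consider "s \<le> m1" | "m1 < s" "s \<le> M1" | "M1 < s" by linarith
    then show ?thesis
    proof cases
      case 1
      have F0: "?F s = 0" using Fm[OF 1, of u] q1(6) Fb[of u s] by simp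
      \<comment> \<open>The logarithm does not reach p = 0, so to the left of the range of
        \<open>K\<close> the value 0 is obtained as a limit of small p.\<close>
      have small: "?G (s + c) \<le> p" if "0 < p" for p
      proof (cases "p \<le> 1")
        case True
        have "s \<le> q1 p" using 1 q1(3)[of p] that True by simp
        then have "?G (s + c) \<le> ?G (q2 p)" using shift[OF that True] by (intro Gm) simp
        then show ?thesis using q2(2)[of p] that True by simp
      qed (use Gb[of u "s + c"] in auto)
      have "?G (s + c) \<le> 0"
      proof (rule field_le_epsilon)
        fix e :: real assume "0 < e"
        from small[OF this] show "?G (s + c) \<le> 0 + e" by simp
      qed
      then show ?thesis using F0 Gb[of u "s + c"] by simp
    next
      case 2
      then have "?F s > 0" using q1(5)[of m1 s] q1(6) by simp
      moreover have "?F s \<le> 1" by (rule Fb)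
      moreover have "q1 (?F s) = s" using q1(4) 2 by simp
      ultimately show ?thesis using shift[of "?F s"] q2(2)[of "?F s"] by simp
    next
      case 3
      have "?F s = 1" using Fm[of M1 s u] 3 q1(7) Fb[of u s] by simp
      moreover have "?G (s + c) = 1" using Gm[of M2 "s + c" u] 3 q2(7) Gb[of u "s + c"] by (simp add: c_def)
      ultimately show ?thesis by simp
    qed
  qed
  then show ?thesis by (rule that)
qed

text \<open>A distribution is determined by its distribution function, so the law for
  \<open>T\<close> is that for \<open>K\<close> moved by \<open>c\<close>; comparing means gives
  \<open>c\<close>.\<close>

lemma expectation_shift:
  fixes K T :: "'a::euclidean_space set"
  assumes K: "compact K" "measure lebesgue K = 1" and T: "compact T" "measure lebesgue T = 1"
    and shift: "\<And>s. halfspace_volume T u (s + c) = halfspace_volume K u s"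
  shows "c = u \<bullet> ((\<integral>x. x \<partial>uniform_measure lborel T) - (\<integral>x. x \<partial>uniform_measure lborel K))"
proof -
  interpret DK: real_distribution "direction_distr K u" by (rule real_distribution_direction[OF K])
  interpret DT: real_distribution "direction_distr T u" by (rule real_distribution_direction[OF T])
  let ?D = "distr (direction_distr K u) borel (\<lambda>x. x + c)"
  interpret D: real_distribution ?D by (rule DK.real_distribution_distr) simp
  have "cdf ?D = cdf (direction_distr T u)"
  proof
    fix s
    have "cdf ?D s = measure (direction_distr K u) ((\<lambda>x. x + c) -` {..s})"
      unfolding cdf_def by (subst measure_distr) auto
    also have "(\<lambda>x. x + c) -` {..s} = {..s - c}" by auto
    also have "measure (direction_distr K u) {..s - c} = halfspace_volume K u (s - c)"
      using cdf_direction[OF K, of u] by (simp add: cdf_def fun_eq_iff)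
    also have "\<dots> = cdf (direction_distr T u) s"
      using shift[of "s - c"] cdf_direction[OF T, of u] by simp
    finally show "cdf ?D s = cdf (direction_distr T u) s" .
  qed
  then have "?D = direction_distr T u"
    by (intro cdf_unique D.real_distribution_axioms DT.real_distribution_axioms)
  then have "(\<integral>x. x \<partial>direction_distr T u) = (\<integral>x. x \<partial>?D)" by simp
  also have "\<dots> = (\<integral>x. x + c \<partial>direction_distr K u)" by (subst integral_distr) auto
  also have "\<dots> = (\<integral>x. x \<partial>direction_distr K u) + c"
    using expectation_direction(2)[OF K, of u] DK.prob_space by simp
  finally show ?thesis
    unfolding expectation_direction(1)[OF K] expectation_direction(1)[OF T] by (simp add: inner_diff_right)
qed

text \<open>A hyperplane separating \<open>y - v\<close> from \<open>K\<close> would, after the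
  shift, put all the volume of \<open>T\<close> on one side while the point \<open>y\<close> of
  \<open>T\<close> lies strictly on the other.\<close>

lemma subset_of_halfspace_volume_shift:
  fixes K T :: "'a::euclidean_space set"
  assumes K: "compact K" "measure lebesgue K = 1" "convex K" "interior K \<noteq> {}"
    and T: "compact T" "measure lebesgue T = 1" "convex T" "interior T \<noteq> {}"
    and shift: "\<And>u s. u \<noteq> 0 \<Longrightarrow> halfspace_volume T u (s + u \<bullet> v) = halfspace_volume K u s"
    and y: "y \<in> T"
  shows "y - v \<in> K"
proof (rule ccontr)
  assume "y - v \<notin> K"
  moreover have "K \<noteq> {}" "closed K" using K by (auto intro: compact_imp_closed)
  ultimately obtain a b where ab: "a \<bullet> (y - v) < b" "\<And>x. x \<in> K \<Longrightarrow> b < a \<bullet> x"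
    using separating_hyperplane_closed_point[of K "y - v"] K by blast
  have a: "- a \<noteq> 0" using ab \<open>K \<noteq> {}\<close> by force
  have 1: "halfspace_volume T (- a) (- b - a \<bullet> v) = 1"
    using shift[OF a, of "- b"] halfspace_volume_eq_1[OF K(1,2), of "- a" "- b"] ab(2) by (force simp: less_imp_le)
  show False
  \<comment> \<open>Strict growth beyond volume 1 needs a point of \<open>T\<close> in the
    half-space; without one the volume there would be 0 instead of 1.\<close>
  proof (cases "\<exists>x\<in>T. - a \<bullet> x \<le> - b - a \<bullet> v")
    case True
    then obtain x where "x \<in> T" "- a \<bullet> x \<le> - b - a \<bullet> v" by blast
    from halfspace_volume_strict_mono[OF T this(1) y this(2) _ order_refl]
    have "1 < halfspace_volume T (- a) (- a \<bullet> y)"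
      using ab(1) 1 by (simp add: inner_diff_right)
    then show False using halfspace_volume_bounds(2)[OF T(1,2), of "- a" "- a \<bullet> y"] by simp
  next
    case False
    then have "halfspace_volume T (- a) (- b - a \<bullet> v) = 0"
      by (intro halfspace_volume_eq_0[OF T(1,2) a]) auto
    then show False using 1 by simp
  qed
qed

theorem brunn_minkowski_equality_unit:
  fixes K T :: "'a::euclidean_space set"
  assumes K: "compact K" "measure lebesgue K = 1" "convex K" "interior K \<noteq> {}"
    and T: "compact T" "measure lebesgue T = 1" "convex T" "interior T \<noteq> {}"
    and M: "measure lebesgue (minkowski_average K T) \<le> 1"
  obtains v where "T = (\<lambda>x. x + v) ` K"
proof -
  \<comment> \<open>The translation carries the centroid of \<open>K\<close> to that of
    \<open>T\<close>.\<close>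
  define v where "v = (\<integral>x. x \<partial>uniform_measure lborel T) - (\<integral>x. x \<partial>uniform_measure lborel K)"
  have shift: "halfspace_volume T u (s + u \<bullet> v) = halfspace_volume K u s" if u: "u \<noteq> 0" for u s
  proof -
    obtain c where c: "\<And>s. halfspace_volume T u (s + c) = halfspace_volume K u s"
      using halfspace_volume_shift[OF K T M u] by blast
    show ?thesis using c expectation_shift[OF K(1,2) T(1,2) c] by (simp add: v_def)
  qed
  have "y - v \<in> K" if "y \<in> T" for y
    by (rule subset_of_halfspace_volume_shift[OF K T shift that])
  moreover have "x + v \<in> T" if "x \<in> K" for x
  proof -
    have "halfspace_volume K u (s + u \<bullet> (- v)) = halfspace_volume T u s" if "u \<noteq> 0" for u s
      using shift[OF that, of "s - u \<bullet> v"] by simp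
    from subset_of_halfspace_volume_shift[OF T K this that] show ?thesis by simp
  qed
  ultimately have "T = (\<lambda>x. x + v) ` K" by (force simp: image_iff)
  then show ?thesis by (rule that)
qed

section \<open>Convex bodies, homotheties and central symmetry\<close>

text \<open>A convex set with empty interior is null, and a null set has empty interior.\<close>

lemma convex_body_iff_measure:
  fixes K :: "'a::euclidean_space set"
  shows "convex_body K \<longleftrightarrow> compact K \<and> convex K \<and> 0 < measure lebesgue K"
proof -
  have "interior K \<noteq> {} \<longleftrightarrow> 0 < measure lebesgue K" if "compact K" "convex K"
    using negligible_convex_interior[OF that(2)] negligible_iff_measure[of K] lmeasurable_compact[OF that(1)]
    by (metis measure_nonneg order_le_less order_less_irrefl)
  then show ?thesis by (auto simp: convex_body_def)
qed

lemma convex_body_affine: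
  fixes K :: "'a::euclidean_space set"
  assumes "convex_body K" "a \<noteq> 0"
  shows "convex_body ((\<lambda>x. a *\<^sub>R x + v) ` K)"
proof -
  have "compact ((\<lambda>x. a *\<^sub>R x + v) ` K)"
    using assms by (intro compact_continuous_image continuous_intros) (auto simp: convex_body_def)
  moreover have "convex ((\<lambda>x. a *\<^sub>R x + v) ` K)"
    using convex_affinity[of K v a] assms by (simp add: convex_body_def add.commute)
  moreover have "0 < measure lebesgue ((\<lambda>x. a *\<^sub>R x + v) ` K)"
    unfolding measure_lebesgue_affine using assms by (simp add: convex_body_iff_measure)
  ultimately show ?thesis by (simp add: convex_body_iff_measure)
qed

lemma homothetic_sym:
  assumes "homothetic_upto_translation K T"
  shows "homothetic_upto_translation T K"
proof -
  obtain a v where a: "a > 0" "T = (\<lambda>x. a *\<^sub>R x + v) ` K"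
    using assms by (auto simp: homothetic_upto_translation_def)
  then have "K = (\<lambda>x. (1/a) *\<^sub>R x + (- (1/a)) *\<^sub>R v) ` T"
    by (simp add: image_image scaleR_add_right)
  then show ?thesis unfolding homothetic_upto_translation_def using a by (metis zero_less_divide_1_iff)
qed

lemma translate_of_sym:
  assumes "translate_of T K"
  shows "translate_of K T"
proof -
  obtain v where "T = (\<lambda>x. x + v) ` K" using assms by (auto simp: translate_of_def)
  then have "K = (\<lambda>x. x + (- v)) ` T" by (simp add: image_image)
  then show ?thesis unfolding translate_of_def by blast
qed

text \<open>The vector \<open>w\<close> is twice the centre of symmetry, so translating by - w / 2
  moves the centre to the origin.\<close>

lemma centrally_symmetric_iff:
  fixes K :: "'a::real_vector set"
  shows "centrally_symmetric_upto_translation K \<longleftrightarrow> (\<exists>w. K = (\<lambda>x. w - x) ` K)"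
proof
  assume "centrally_symmetric_upto_translation K"
  then obtain v where v: "(\<lambda>x. x + v) ` K = uminus ` (\<lambda>x. x + v) ` K"
    by (auto simp: centrally_symmetric_upto_translation_def translate_of_def)
  have "K = (\<lambda>x. x - v) ` (\<lambda>x. x + v) ` K" by (simp add: image_image)
  also have "\<dots> = (\<lambda>x. (- 2 *\<^sub>R v) - x) ` K"
  proof -
    have "- (x + v) - v = - 2 *\<^sub>R v - x" for x by (simp add: scaleR_2)
    then show ?thesis by (subst v) (simp only: image_image)
  qed
  finally show "\<exists>w. K = (\<lambda>x. w - x) ` K" by blast
next
  assume "\<exists>w. K = (\<lambda>x. w - x) ` K"
  then obtain w where w: "K = (\<lambda>x. w - x) ` K" by blast
  let ?M = "(\<lambda>x. x + (- (1/2)) *\<^sub>R w) ` K"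
  have "?M = (\<lambda>x. x + (- (1/2)) *\<^sub>R w) ` (\<lambda>x. w - x) ` K" using w by simp
  also have "\<dots> = uminus ` ?M"
  proof -
    have "w - x + (- (1/2)) *\<^sub>R w = - (x + (- (1/2)) *\<^sub>R w)" for x
      using scaleR_half_double[of w] by (simp add: algebra_simps)
    then show ?thesis by (simp only: image_image)
  qed
  finally have "?M = uminus ` ?M" .
  moreover have "translate_of ?M K" unfolding translate_of_def by blast
  ultimately show "centrally_symmetric_upto_translation K"
    unfolding centrally_symmetric_upto_translation_def by blast
qed

text \<open>A sum a x + b y is (a + b) times the convex combination of x and y with weights a / (a +
  b) and b / (a + b), which stays in \<open>S\<close>.\<close>

lemma convex_scaled_sum:
  fixes S :: "'a::real_vector set"
  assumes "convex S" "0 \<le> a" "0 \<le> b"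
  shows "(\<lambda>x. a *\<^sub>R x + v) ` S + (\<lambda>x. b *\<^sub>R x + w) ` S = (\<lambda>x. (a + b) *\<^sub>R x + (v + w)) ` S"
proof
  show "(\<lambda>x. (a + b) *\<^sub>R x + (v + w)) ` S \<subseteq> (\<lambda>x. a *\<^sub>R x + v) ` S + (\<lambda>x. b *\<^sub>R x + w) ` S"
  proof
    fix z assume "z \<in> (\<lambda>x. (a + b) *\<^sub>R x + (v + w)) ` S"
    then obtain x where "x \<in> S" "z = (a *\<^sub>R x + v) + (b *\<^sub>R x + w)"
      by (auto simp: algebra_simps)
    then show "z \<in> (\<lambda>x. a *\<^sub>R x + v) ` S + (\<lambda>x. b *\<^sub>R x + w) ` S" by blast
  qed
  show "(\<lambda>x. a *\<^sub>R x + v) ` S + (\<lambda>x. b *\<^sub>R x + w) ` S \<subseteq> (\<lambda>x. (a + b) *\<^sub>R x + (v + w)) ` S"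
  proof
    fix z assume "z \<in> (\<lambda>x. a *\<^sub>R x + v) ` S + (\<lambda>x. b *\<^sub>R x + w) ` S"
    then obtain x y where xy: "x \<in> S" "y \<in> S" "z = (a *\<^sub>R x + v) + (b *\<^sub>R y + w)"
      by (auto simp: set_plus_def)
    show "z \<in> (\<lambda>x. (a + b) *\<^sub>R x + (v + w)) ` S"
    proof (cases "a + b = 0")
      case True
      then have "a = 0" "b = 0" using assms by auto
      then show ?thesis using xy by auto
    next
      case False
      define c where "c = (a / (a + b)) *\<^sub>R x + (b / (a + b)) *\<^sub>R y"
      have "a / (a + b) + b / (a + b) = 1" using False by (simp add: add_divide_distrib[symmetric])
      then have "c \<in> S" unfolding c_def using assms xy by (intro convexD) auto
      moreover have "(a + b) *\<^sub>R c = a *\<^sub>R x + b *\<^sub>R y"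
        using False by (simp add: c_def scaleR_add_right)
      ultimately show ?thesis using xy by (intro image_eqI[of _ _ c]) (auto simp: algebra_simps)
    qed
  qed
qed

text \<open>The open set \<open>interior K - A\<close> is null, hence empty, and a convex body is
  the closure of its interior.\<close>

lemma compact_subset_eq_convex_body:
  fixes A K :: "'a::euclidean_space set"
  assumes A: "compact A" "A \<subseteq> K" and K: "convex_body K" and m: "measure lebesgue K \<le> measure lebesgue A"
  shows "A = K"
proof -
  have cK: "compact K" "convex K" "interior K \<noteq> {}" using K by (auto simp: convex_body_def)
  have lm: "A \<in> lmeasurable" "K \<in> lmeasurable" using A cK by (auto intro: lmeasurable_compact)
  have "measure lebesgue (K - A) = measure lebesgue K - measure lebesgue A"
    using lm A by (intro measurable_measure_Diff) (auto simp: fmeasurableD)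
  then have "measure lebesgue (K - A) = 0" using m measure_nonneg[of lebesgue "K - A"] by simp
  then have "negligible (K - A)"
    using lm by (simp add: negligible_iff_measure fmeasurable.Diff)
  then have "negligible (interior K - A)" by (rule negligible_subset) (use interior_subset in blast)
  moreover have "open (interior K - A)" using A by (auto intro: open_Diff compact_imp_closed)
  ultimately have "interior K \<subseteq> A" using open_not_negligible by blast
  then have "closure (interior K) \<subseteq> A" using A by (simp add: closure_minimal compact_imp_closed)
  then have "K \<subseteq> A"
    using convex_closure_interior[OF cK(2,3)] cK(1) by (simp add: closure_closed compact_imp_closed)
  then show ?thesis using A by blast
qed

lemma set_plus_scaleR:
  fixes A B :: "'a::real_vector set"
  shows "(\<lambda>x. a *\<^sub>R x + 0) ` A + (\<lambda>x. a *\<^sub>R x + 0) ` B = (\<lambda>x. a *\<^sub>R x + 0) ` (A + B)"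
  by (force simp: set_plus_def scaleR_add_right)

section \<open>Equality in the Brunn-Minkowski inequality for arbitrary volumes\<close>

lemma brunn_minkowski_equality_same_volume:
  fixes K T :: "'a::euclidean_space set"
  assumes K: "convex_body K" and T: "convex_body T"
    and eq: "measure lebesgue K = k ^ DIM('a)" "measure lebesgue T = k ^ DIM('a)" "0 < k"
    and sum: "measure lebesgue (K + T) \<le> (2 * k) ^ DIM('a)"
  obtains v where "T = (\<lambda>x. x + v) ` K"
proof -
  let ?s = "\<lambda>A. (\<lambda>x. (1/k) *\<^sub>R x + 0) ` A :: 'a set"
  have m: "measure lebesgue (?s A) = measure lebesgue A / k ^ DIM('a)" for A
    unfolding measure_lebesgue_affine using eq(3) by (simp add: power_one_over)
  have 1: "measure lebesgue (?s K) = 1" "measure lebesgue (?s T) = 1"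
    unfolding m eq using eq(3) by simp_all
  have b: "convex_body (?s K)" "convex_body (?s T)"
    using convex_body_affine[OF K, of "1/k" 0] convex_body_affine[OF T, of "1/k" 0] eq(3) by auto
  have "measure lebesgue (minkowski_average (?s K) (?s T)) \<le> 1"
    unfolding measure_minkowski_average set_plus_scaleR m
    using sum eq(3) by (simp add: field_simps)
  then obtain v where v: "?s T = (\<lambda>x. x + v) ` ?s K"
    using brunn_minkowski_equality_unit[of "?s K" "?s T"] b 1 by (metis convex_body_def)
  have "T = (\<lambda>x. k *\<^sub>R x) ` ?s T" using eq(3) by (simp add: image_image)
  also have "\<dots> = (\<lambda>x. x + k *\<^sub>R v) ` K"
    unfolding v using eq(3) by (simp add: image_image scaleR_add_right)
  finally show ?thesis by (rule that)
qed

text \<open>The larger body is shrunk to the volume of the smaller one. By convexity it is the sum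
  of this copy and a remainder, and Brunn-Minkowski for the remainder shows that equality passes to
  the bodies of equal volume.\<close>

theorem brunn_minkowski_equality:
  fixes K T :: "'a::euclidean_space set"
  assumes K: "convex_body K" and T: "convex_body T"
    and sum: "root DIM('a) (measure lebesgue (K + T)) \<le> root DIM('a) (measure lebesgue K) + root DIM('a) (measure lebesgue T)"
  shows "homothetic_upto_translation K T"
  using assms
proof (induction "measure lebesgue K" "measure lebesgue T" arbitrary: K T rule: linorder_wlog)
  case sym
  have "homothetic_upto_translation T K"
    using sym.prems by (intro sym.hyps) (simp_all add: add.commute)
  then show ?case by (rule homothetic_sym)
next
  case (le K T)
  define n where "n = DIM('a)"
  have n: "0 < n" by (simp add: n_def)
  define k t where "k = root n (measure lebesgue K)" and "t = root n (measure lebesgue T)"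
  have kt: "0 < k" "k \<le> t" "0 < t" "k ^ n = measure lebesgue K" "t ^ n = measure lebesgue T"
    using n le by (auto simp: k_def t_def convex_body_iff_measure)
  let ?T = "(\<lambda>x. (k/t) *\<^sub>R x + 0) ` T"
  \<comment> \<open>The remainder after shrinking \<open>T\<close> by k / t; if k = t it is a single
    point, of volume 0.\<close>
  let ?T' = "(\<lambda>x. (1 - k/t) *\<^sub>R x + 0) ` T"
  have cv: "compact K" "compact T" "convex T" "K \<noteq> {}" "T \<noteq> {}"
    using le by (auto simp: convex_body_def)
  have bT: "convex_body ?T" using convex_body_affine[OF le(3), of "k/t" 0] kt by simp
  have cT': "compact ?T'" using cv by (intro compact_continuous_image continuous_intros)
  have m: "measure lebesgue ?T = k ^ n" "measure lebesgue ?T' = (t - k) ^ n"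
    unfolding measure_lebesgue_affine n_def[symmetric] kt(5)[symmetric]
    using kt(1-3) by (simp_all add: power_mult_distrib[symmetric] left_diff_distrib)
  have "root n (measure lebesgue (K + ?T)) + root n (measure lebesgue ?T') \<le> root n (measure lebesgue (K + T))"
    unfolding n_def
  proof (rule brunn_minkowski)
    fix x y assume "x \<in> K + ?T" "y \<in> ?T'"
    from this(1) obtain z w where "z \<in> K" "w \<in> ?T" "x = z + w" by (rule set_plus_elim)
    with \<open>y \<in> ?T'\<close> have "x + y \<in> K + (?T + ?T')" by (metis add.assoc set_plus_intro)
    also have "?T + ?T' = T"
      using convex_scaled_sum[OF cv(3), of "k/t" "1 - k/t" 0 0] kt by simp
    finally show "x + y \<in> K + T" .
  next
    show "K + ?T \<noteq> {}" using cv by (auto simp: set_plus_def)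
    show "K + ?T \<in> fmeasurable lborel" "?T' \<in> fmeasurable lborel" "K + T \<in> fmeasurable lborel" "?T' \<noteq> {}"
      using cv bT cT' by (auto intro!: fmeasurable_compact compact_set_plus simp: convex_body_def)
  qed
  also have "\<dots> \<le> k + t" using le(4) by (simp add: k_def t_def n_def)
  also have "root n (measure lebesgue ?T') = t - k"
    unfolding m using kt n by (simp add: real_root_power_cancel)
  finally have "root n (measure lebesgue (K + ?T)) \<le> 2 * k" by simp
  then have "root n (measure lebesgue (K + ?T)) ^ n \<le> (2 * k) ^ n"
    using n by (intro power_mono) auto
  then have "measure lebesgue (K + ?T) \<le> (2 * k) ^ n" using n by simp
  then obtain v where v: "?T = (\<lambda>x. x + v) ` K"
    using brunn_minkowski_equality_same_volume[OF le(2) bT, of k] kt m by (auto simp: n_def)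
  have "T = (\<lambda>x. (t/k) *\<^sub>R x) ` ?T" using kt by (simp add: image_image)
  also have "\<dots> = (\<lambda>x. (t/k) *\<^sub>R x + (t/k) *\<^sub>R v) ` K"
    unfolding v by (simp add: image_image scaleR_add_right)
  finally show ?case unfolding homothetic_upto_translation_def using kt by (metis divide_pos_pos)
qed

section \<open>Equality for sums of boundaries\<close>

lemma frontier_sum_equality_imp:
  fixes K T :: "'a::euclidean_space set"
  assumes K: "convex_body K" "connected (frontier K)" and T: "convex_body T" "connected (frontier T)"
    and vol: "measure lebesgue T \<le> measure lebesgue K" and dim: "2 \<le> DIM('a)"
    and eq: "measure lebesgue (minkowski_average (frontier K) (frontier T)) = sqrt (measure lebesgue K * measure lebesgue T)"
  shows "translate_of T K \<or> (DIM('a) = 2 \<and> homothetic_upto_translation K T \<and>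
    centrally_symmetric_upto_translation K \<and> centrally_symmetric_upto_translation T)"
proof -
  define n where "n = DIM('a)"
  have n: "0 < n" "2 \<le> n" using dim by (simp_all add: n_def)
  define k t where "k = root n (measure lebesgue K)" and "t = root n (measure lebesgue T)"
  have kt: "0 < k" "0 < t" "t \<le> k" "k ^ n = measure lebesgue K" "t ^ n = measure lebesgue T"
    using n vol K(1) T(1) by (simp_all add: k_def t_def convex_body_iff_measure)
  have cv: "compact K" "convex K" "K \<noteq> {}" "compact T" "convex T" "T \<noteq> {}"
    using K T by (auto simp: convex_body_def)
  let ?F = "frontier K + frontier T"
  note fv = frontier_sum_volumes[OF cv(1,3) K(2) cv(4,6) T(2) vol, folded n_def, folded k_def t_def]
  have lower: "(k + t) ^ n \<le> measure lebesgue (K + T)"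
    using power_mono[OF fv(2), of n] kt n by simp
  have upper: "measure lebesgue (K + T - ?F) \<le> (k - t) ^ n"
    using power_mono[OF fv(3), of n] kt n by simp
  have F: "measure lebesgue ?F = 2 ^ n * sqrt (k ^ n * t ^ n)"
    using eq unfolding measure_minkowski_average n_def[symmetric] kt(4,5) by (simp add: field_simps)
  have powers: "2 ^ n * sqrt (k ^ n * t ^ n) \<le> (k + t) ^ n - (k - t) ^ n"
    using difference_of_powers_ge(1)[of t k n] kt(1-3) n by simp
  \<comment> \<open>The three inequalities form a chain whose two ends agree, so each of them is an
    equality.\<close>
  have volKT: "measure lebesgue (K + T) = (k + t) ^ n"
    and volE: "measure lebesgue (K + T - ?F) = (k - t) ^ n"
    and numeric: "2 ^ n * sqrt (k ^ n * t ^ n) = (k + t) ^ n - (k - t) ^ n"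
    using lower upper F powers fv(1) by linarith+
  have "root n (measure lebesgue (K + T)) = k + t"
    unfolding volKT using kt n by (simp add: real_root_power_cancel)
  then have hom: "homothetic_upto_translation K T"
    by (intro brunn_minkowski_equality K T) (simp add: k_def t_def n_def)
  then obtain a v where a: "0 < a" and T_eq: "T = (\<lambda>x. a *\<^sub>R x + v) ` K"
    by (auto simp: homothetic_upto_translation_def)
  have "t ^ n = (a * k) ^ n"
    unfolding kt(5) T_eq measure_lebesgue_affine n_def[symmetric] power_mult_distrib kt(4) using a by simp
  then have tak: "t = a * k" using kt a n by (simp add: power_eq_iff_eq_base)
  show ?thesis
  proof (cases "t = k")
    case True
    then have "a = 1" using tak kt by simp
    then have "translate_of T K" unfolding translate_of_def T_eq by auto
    then show ?thesis ..
  next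
    case False
    then have tk: "t < k" using kt by simp
    have n2: "n = 2" using difference_of_powers_ge(2)[OF _ kt(3) n(2) numeric] kt(2) False n by linarith
    let ?S = "(\<lambda>x. (-1) *\<^sub>R x + 0) ` T"
    \<comment> \<open>Since \<open>D - T \<subseteq> K\<close> with equality in Brunn-Minkowski, \<open>D\<close> is homothetic to \<open>- T\<close>, hence so is \<open>K\<close>.\<close>
    define D where "D = (\<Inter>y\<in>T. (+) y ` K)"
    have D_iff: "z \<in> D \<longleftrightarrow> (\<forall>y\<in>T. z - y \<in> K)" for z
      unfolding D_def by (force simp: image_iff algebra_simps)
    have cD: "compact D" "convex D"
      unfolding D_def using cv by (auto intro!: compact_Inter convex_INT compact_translation convex_translation)
    \<comment> \<open>Brunn-Minkowski equality is available only for convex bodies, so the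
      complement of the boundary sum is replaced by the compact convex set \<open>D\<close>, whose
      volume is thereby at least as large.\<close>
    have "K + T - ?F \<subseteq> D"
      using set_plus_minus_frontiers[OF cv(1,4) K(2) T(2) vol] interior_subset[of K]
      by (intro subsetI) (simp add: D_iff subset_iff)
    moreover have "compact (K + T)" "compact ?F"
      using cv by (auto intro: compact_set_plus compact_frontier)
    ultimately have volD: "(k - t) ^ n \<le> measure lebesgue D"
      unfolding volE[symmetric] using cD
      by (intro measure_mono_fmeasurable sets.Diff fmeasurableD lmeasurable_compact)
    moreover have "0 < (k - t) ^ n" using tk by simp
    ultimately have bD: "convex_body D" using cD by (simp add: convex_body_iff_measure)
    have bS: "convex_body ?S" by (rule convex_body_affine[OF T(1)]) simp
    have volS: "measure lebesgue ?S = t ^ n" unfolding measure_lebesgue_affine kt(5) by simp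
    have DS: "D + ?S \<subseteq> K" by (auto simp: set_plus_def D_iff)
    have cDS: "compact (D + ?S)" using bD bS by (auto intro: compact_set_plus simp: convex_body_def)
    have "measure lebesgue (D + ?S) \<le> measure lebesgue K"
      using DS cDS cv by (intro measure_mono_fmeasurable) (auto intro: fmeasurableD lmeasurable_compact)
    then have "root n (measure lebesgue (D + ?S)) \<le> k" using n by (simp add: k_def)
    moreover have "k - t \<le> root n (measure lebesgue D)"
      using real_root_le_mono[OF n(1) volD] tk n by (simp add: real_root_power_cancel)
    moreover have "root n (measure lebesgue ?S) = t"
      unfolding volS using kt(2) n by (simp add: real_root_power_cancel)
    ultimately have sum: "root DIM('a) (measure lebesgue (D + ?S)) \<le> root DIM('a) (measure lebesgue D) + root DIM('a) (measure lebesgue ?S)"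
      unfolding n_def by linarith
    have "root n (measure lebesgue D) + root n (measure lebesgue ?S) \<le> root n (measure lebesgue (D + ?S))"
      unfolding n_def using bD bS cDS
      by (intro brunn_minkowski) (auto intro: fmeasurable_compact simp: convex_body_def simp del: scaleR_minus1_left)
    then have "k \<le> root n (measure lebesgue (D + ?S))"
      using \<open>k - t \<le> root n (measure lebesgue D)\<close> \<open>root n (measure lebesgue ?S) = t\<close> by simp
    then have "measure lebesgue K \<le> measure lebesgue (D + ?S)" using n by (simp add: k_def)
    \<comment> \<open>A compact subset of a convex body with the same volume is all of it.\<close>
    then have K_eq: "D + ?S = K" by (rule compact_subset_eq_convex_body[OF cDS DS K(1)])
    obtain b w where b: "0 < b" and D_eq: "D = (\<lambda>x. b *\<^sub>R x + w) ` ?S"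
      using homothetic_sym[OF brunn_minkowski_equality[OF bD bS sum]] by (auto simp: homothetic_upto_translation_def)
    \<comment> \<open>As \<open>D\<close> is a scaled copy of \<open>- T\<close> and
      \<open>T\<close> one of \<open>K\<close>, this writes \<open>K\<close> as a negative multiple
      of itself up to translation. Comparing volumes makes the factor -1.\<close>
    have "K = (\<lambda>x. b *\<^sub>R x + w) ` ?S + (\<lambda>x. 1 *\<^sub>R x + 0) ` ?S" using K_eq D_eq by simp
    also have "\<dots> = (\<lambda>x. (b + 1) *\<^sub>R x + (w + 0)) ` ?S"
      using bS b by (intro convex_scaled_sum) (auto simp: convex_body_def)
    also have "\<dots> = (\<lambda>x. (- ((b + 1) * a)) *\<^sub>R x + (w - (b + 1) *\<^sub>R v)) ` K"
      by (simp add: T_eq image_image algebra_simps)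
    finally have KK: "K = (\<lambda>x. (- ((b + 1) * a)) *\<^sub>R x + (w - (b + 1) *\<^sub>R v)) ` K" .
    have "measure lebesgue K = ((b + 1) * a) ^ n * measure lebesgue K"
      by (subst KK, subst measure_lebesgue_affine) (use a b in \<open>simp add: n_def\<close>)
    then have "((b + 1) * a) ^ n = 1 ^ n" using K(1) by (simp add: convex_body_iff_measure)
    then have "(b + 1) * a = 1" using a b n by (subst (asm) power_eq_iff_eq_base) auto
    then have sK: "K = (\<lambda>x. (w - (b + 1) *\<^sub>R v) - x) ` K" using KK by simp
    define w' where "w' = w - (b + 1) *\<^sub>R v"
    have "T = (\<lambda>x. a *\<^sub>R x + v) ` (\<lambda>x. w' - x) ` K" using T_eq sK by (simp add: w'_def)
    also have "\<dots> = (\<lambda>x. (a *\<^sub>R w' + 2 *\<^sub>R v) - x) ` T"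
      unfolding T_eq image_image by (intro image_cong) (auto simp: algebra_simps scaleR_2)
    finally have "centrally_symmetric_upto_translation T" unfolding centrally_symmetric_iff by blast
    moreover have "centrally_symmetric_upto_translation K" unfolding centrally_symmetric_iff using sK by blast
    ultimately show ?thesis using hom n2 unfolding n_def by simp
  qed
qed

section \<open>Sufficiency of the equality conditions\<close>

text \<open>The boundary sum lies in \<open>K + T\<close>, which by convexity is a translate of 2
  K.\<close>

lemma frontier_sum_equality_translate:
  fixes K T :: "'a::euclidean_space set"
  assumes K: "convex_body K" and tr: "translate_of T K"
  shows "measure lebesgue (minkowski_average (frontier K) (frontier T)) \<le> sqrt (measure lebesgue K * measure lebesgue T)"
proof -
  obtain v where v: "T = (\<lambda>x. 1 *\<^sub>R x + v) ` K" using tr by (auto simp: translate_of_def)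
  have cv: "compact K" "compact T" "convex K" using K unfolding v by (auto simp: convex_body_def intro!: compact_continuous_image continuous_intros)
  have "K + T = (\<lambda>x. 2 *\<^sub>R x + v) ` K"
    using convex_scaled_sum[OF cv(3), of 1 1 0 v] unfolding v by simp
  then have "measure lebesgue (K + T) = 2 ^ DIM('a) * measure lebesgue K"
    by (simp only: measure_lebesgue_affine abs_numeral)
  moreover have "measure lebesgue (frontier K + frontier T) \<le> measure lebesgue (K + T)"
    using cv by (intro measure_mono_fmeasurable set_plus_mono2 frontier_subset_compact fmeasurableD
      lmeasurable_compact compact_set_plus compact_frontier)
  moreover have "measure lebesgue T = measure lebesgue K"
    unfolding v measure_lebesgue_affine by simp
  ultimately show ?thesis unfolding measure_minkowski_average by (simp add: field_simps)
qed

text \<open>A translate of (1 - a) times the interior of \<open>K\<close> avoids the boundary sum.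
  In the plane this leaves at most ((1 + a)^2 - (1 - a)^2) V = 4 a V, where V is the volume of
  \<open>K\<close>, and halving divides it by 4.\<close>

lemma frontier_sum_equality_symmetric:
  fixes K T :: "'a::euclidean_space set"
  assumes K: "convex_body K" and T: "convex_body T" and vol: "measure lebesgue T \<le> measure lebesgue K"
    and dim: "DIM('a) = 2" and hom: "homothetic_upto_translation K T" and cs: "centrally_symmetric_upto_translation K"
  shows "measure lebesgue (minkowski_average (frontier K) (frontier T)) \<le> sqrt (measure lebesgue K * measure lebesgue T)"
proof -
  obtain a v where a: "0 < a" and T_eq: "T = (\<lambda>x. a *\<^sub>R x + v) ` K"
    using hom by (auto simp: homothetic_upto_translation_def)
  obtain w where w: "K = (\<lambda>x. w - x) ` K" using cs by (auto simp: centrally_symmetric_iff)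
  define V where "V = measure lebesgue K"
  have V: "0 < V" using K by (simp add: V_def convex_body_iff_measure)
  have volT: "measure lebesgue T = a\<^sup>2 * V" unfolding T_eq measure_lebesgue_affine dim V_def by simp
  then have "a\<^sup>2 \<le> 1" using vol V by (simp add: V_def[symmetric])
  then have a1: "a \<le> 1" using a by (simp add: power2_le_iff_abs_le[of 1 a, simplified] abs_square_le_1)
  show ?thesis
  proof (cases "a = 1")
    case True
    then have "translate_of T K" unfolding translate_of_def T_eq by auto
    then show ?thesis by (rule frontier_sum_equality_translate[OF K])
  next
    case False
    then have a1: "a < 1" using a1 by simp
    let ?F = "frontier K + frontier T"
    have cv: "compact K" "convex K" "compact T" "T \<noteq> {}" using K T by (auto simp: convex_body_def)
    have cKT: "compact (K + T)" "compact ?F" using cv by (auto intro: compact_set_plus compact_frontier)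
    have "K + T = (\<lambda>x. (1 + a) *\<^sub>R x + v) ` K"
      using convex_scaled_sum[OF cv(2), of 1 a 0 v] a unfolding T_eq by simp
    then have volKT: "measure lebesgue (K + T) = (1 + a)\<^sup>2 * V"
      by (simp only: measure_lebesgue_affine dim V_def) simp
    \<comment> \<open>The shift is chosen so that z - T becomes (1 - a) x + a (w - K), which by
      symmetry is (1 - a) x + a K.\<close>
    let ?G = "(\<lambda>x. (1 - a) *\<^sub>R x + (a *\<^sub>R w + v)) ` interior K"
    have G: "?G \<subseteq> K + T - ?F"
    proof
      fix z assume "z \<in> ?G"
      then obtain x where x: "x \<in> interior K" and z: "z = (1 - a) *\<^sub>R x + (a *\<^sub>R w + v)" by auto
      have zT: "z - y \<in> interior K" if yT: "y \<in> T" for y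
      proof -
        obtain y' where y': "y' \<in> K" "y = a *\<^sub>R y' + v" using yT unfolding T_eq by blast
        have "w - y' \<in> K" using w y'(1) by blast
        \<comment> \<open>This point divides the segment from \<open>w - y'\<close> in
          \<open>K\<close> to the interior point \<open>x\<close>; as 1 - a > 0, it is
          interior.\<close>
        then have "(w - y') - (1 - a) *\<^sub>R ((w - y') - x) \<in> interior K"
          using cv(2) x a a1 by (intro mem_interior_convex_shrink) auto
        also have "(w - y') - (1 - a) *\<^sub>R ((w - y') - x) = z - y"
          unfolding z y' by (simp add: algebra_simps)
        finally show ?thesis .
      qed
      obtain y where "y \<in> T" using cv(4) by blast
      then have "z \<in> K + T" using zT interior_subset[of K] set_plus_intro[of "z - y" K y T] by auto
      moreover have "z \<notin> ?F"
      proof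
        assume "z \<in> ?F"
        then obtain p q where "p \<in> frontier K" "q \<in> frontier T" "z = p + q" by (rule set_plus_elim)
        moreover have "q \<in> T" using frontier_subset_compact[OF cv(3)] \<open>q \<in> frontier T\<close> by blast
        ultimately show False using zT[of q] by (auto simp: frontier_def)
      qed
      ultimately show "z \<in> K + T - ?F" by blast
    qed
    \<comment> \<open>The boundary of a convex set is null, so the interior of \<open>K\<close> has
      full volume V.\<close>
    have "(1 - a)\<^sup>2 * V = measure lebesgue ?G"
      unfolding measure_lebesgue_affine dim V_def
      using measure_interior[of K] negligible_convex_frontier[OF cv(2)] compact_imp_bounded[OF cv(1)] by simp
    also have "\<dots> \<le> measure lebesgue (K + T - ?F)"
    proof (rule measure_mono_fmeasurable[OF G])
      have "?G = (\<lambda>x. (a *\<^sub>R w + v) + x) ` (\<lambda>x. (1 - a) *\<^sub>R x) ` interior K"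
        by (simp add: image_image add.commute)
      moreover have "open \<dots>" using a1 by (intro open_translation open_scaling) auto
      ultimately show "?G \<in> sets lebesgue" by (metis borel_open sets_completionI_sets sets_lborel)
    qed (intro fmeasurable.Diff fmeasurableD lmeasurable_compact cKT)
    also have "\<dots> = (1 + a)\<^sup>2 * V - measure lebesgue ?F"
      unfolding volKT[symmetric] using cKT cv
      by (intro measurable_measure_Diff set_plus_mono2 frontier_subset_compact fmeasurableD lmeasurable_compact)
    finally have "measure lebesgue ?F \<le> ((1 + a)\<^sup>2 - (1 - a)\<^sup>2) * V" by (simp add: algebra_simps)
    also have "(1 + a)\<^sup>2 - (1 - a)\<^sup>2 = 4 * a" by (simp add: power2_eq_square algebra_simps)
    finally have "measure lebesgue (minkowski_average (frontier K) (frontier T)) \<le> a * V"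
      unfolding measure_minkowski_average dim by simp
    also have "a * V = sqrt (measure lebesgue K * measure lebesgue T)"
      unfolding volT V_def[symmetric] using a V by (simp add: real_sqrt_mult power2_eq_square mult_ac)
    finally show ?thesis .
  qed
qed

section \<open>Removing the order of the volumes\<close>

theorem frontier_sum_inequality:
  fixes K T :: "'a::euclidean_space set"
  assumes dim: "2 \<le> DIM('a)" and K: "compact K" "connected (frontier K)" and T: "compact T" "connected (frontier T)"
  shows "sqrt (measure lebesgue K * measure lebesgue T) \<le> measure lebesgue (minkowski_average (frontier K) (frontier T))"
proof (cases "K = {} \<or> T = {}")
  case True
  then show ?thesis by auto
next
  case False
  then show ?thesis
    using frontier_sum_lower_bound[of K T] frontier_sum_lower_bound[of T K] assms
    by (cases "measure lebesgue T \<le> measure lebesgue K") (auto simp: minkowski_average_commute[of "frontier T"] mult.commute)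
qed

theorem frontier_sum_equality:
  fixes K T :: "'a::euclidean_space set"
  assumes dim: "2 \<le> DIM('a)" and K: "convex_body K" "connected (frontier K)" and T: "convex_body T" "connected (frontier T)"
  shows "measure lebesgue (minkowski_average (frontier K) (frontier T)) = sqrt (measure lebesgue K * measure lebesgue T)
    \<longleftrightarrow> translate_of T K \<or> (DIM('a) = 2 \<and> homothetic_upto_translation K T \<and>
      centrally_symmetric_upto_translation K \<and> centrally_symmetric_upto_translation T)"
  using K T
\<comment> \<open>Both sides of the equivalence are symmetric in \<open>K\<close> and
  \<open>T\<close>, so \<open>T\<close> may be taken to have the smaller volume.\<close>
proof (induction "measure lebesgue T" "measure lebesgue K" arbitrary: K T rule: linorder_wlog)
  case sym
  then show ?case
    using sym.hyps[OF refl refl sym.prems(3,4,1,2)] translate_of_sym homothetic_sym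
    by (simp add: minkowski_average_commute mult.commute) blast
next
  case (le K T)
  have "sqrt (measure lebesgue K * measure lebesgue T) \<le> measure lebesgue (minkowski_average (frontier K) (frontier T))"
    using le dim by (intro frontier_sum_inequality) (auto simp: convex_body_def)
  then show ?case
    using frontier_sum_equality_imp[of K T] frontier_sum_equality_translate[of K T]
      frontier_sum_equality_symmetric[of K T] le dim by (meson order_antisym)
qed

theorem theorem1p1:
  fixes K T :: "(real ^ 'n) set"
  assumes "CARD('n) \<ge> 2"
    and "compact K" and "connected (frontier K)"
    and "compact T" and "connected (frontier T)"
  shows "measure lebesgue (minkowski_average (frontier K) (frontier T))
           \<ge> sqrt (measure lebesgue K * measure lebesgue T)
    \<and> (convex_body K \<and> convex_body T \<longrightarrow>
         (measure lebesgue (minkowski_average (frontier K) (frontier T))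
            = sqrt (measure lebesgue K * measure lebesgue T)
          \<longleftrightarrow>
          translate_of T K \<or>
          (CARD('n) = 2 \<and> homothetic_upto_translation K T \<and>
           centrally_symmetric_upto_translation K \<and>
           centrally_symmetric_upto_translation T)))"
  using frontier_sum_inequality[of K T] frontier_sum_equality[of K T] assms by simp

end
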